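(* Let $\lambda$ be a regular uncountable cardinal such that $\lambda^{<\lambda}=\lambda$ and $\mathrm{cov}(\mathbf{M}^\lambda_{\lambda,\lambda})=2^\lambda$. Then there exists a very reasonable ultrafilter on $\lambda$.
   Context: The space ${}^\lambda\lambda$ carries the topology whose basic open sets are $\emptyset$ and $O_s=\{f\in{}^\lambda\lambda:s\subseteq f\}$ for $s\in{}^{<\lambda}\lambda$. $\mathbf{M}^\lambda_{\lambda,\lambda}$ is the $({<}\lambda)$-complete ideal of subsets of ${}^\lambda\lambda$ generated by the nowhere dense sets, and $\mathrm{cov}(\mathbf{M}^\lambda_{\lambda,\lambda})$ is the least size of a family $\mathcal{A}\subseteq\mathbf{M}^\lambda_{\lambda,\lambda}$ with $\bigcup\mathcal{A}={}^\lambda\lambda$. $\mathbb{Q}^0_\lambda$ is the set of all tuples $p=(C^p,\langle Z^p_\delta:\delta\in C^p\rangle,\langle d^p_\delta:\delta\in C^p\rangle)$ such that $C^p$ is a club of $\lambda$ consisting of limit ordinals and, for $\delta\in C^p$, $Z^p_\delta=[\delta,\min(C^p\setminus(\delta+1)))$ and $d^p_\delta$ is an ultrafilter on $Z^p_\delta$. For $q\in\mathbb{Q}^0_\lambda$, $\mathrm{fil}(q)=\{A\subseteq\lambda:\exists\varepsilon<\lambda\ \forall\delta\in C^q\setminus\varepsilon\ (A\cap Z^q_\delta\in d^q_\delta)\}$, and for $G\subseteq\mathbb{Q}^0_\lambda$, $\mathrm{fil}(G)=\bigcup_{p\in G}\mathrm{fil}(p)$. $p\le^0 q$ iff $\mathrm{fil}(p)\subseteq\mathrm{fil}(q)$.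 A uniform ultrafilter on $\lambda$ is one all of whose members have size $\lambda$; $\mathcal{F}_\lambda$ is the family of non-decreasing unbounded functions $\lambda\to\lambda$; a uniform ultrafilter $D$ on $\lambda$ is weakly reasonable if for every $f\in\mathcal{F}_\lambda$ there is a club $C$ of $\lambda$ with $\bigcup\{[\delta,\delta+f(\delta)):\delta\in C\}\notin D$. An ultrafilter $D$ on $\lambda$ is very reasonable if it is weakly reasonable and there is a set $G^*\subseteq\mathbb{Q}^0_\lambda$ which is $({<}\lambda^+)$-directed with respect to $\le^0$ (every subset of $G^*$ of size at most $\lambda$ has a $\le^0$-upper bound in $G^*$) such that $D=\mathrm{fil}(G^* )$. *)

theory Defs
  imports "HOL-Analysis.Function_Topology"
begin

unbundle cardinal_syntax

text \<open>
  The cardinal \<open>\<lambda>\<close> is represented by a type \<open>'a\<close> of class \<^class>\<open>wellorder\<close> whose order is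
  an initial one, i.e. \<open>card_order (lam :: 'a rel)\<close>. Elements of \<open>'a\<close> are the ordinals below \<open>\<lambda>\<close>,
  and \<open>{..<\<alpha>}\<close> is the ordinal \<open>\<alpha>\<close> seen as a set.
\<close>

definition lam :: "'a::wellorder rel" where
  "lam = {(\<alpha>, \<beta>). \<alpha> \<le> \<beta>}"

subsection \<open>Ordinals below \<open>\<lambda>\<close>\<close>

text \<open>Zero does not count as a limit.\<close>

definition is_limit :: "'a::wellorder \<Rightarrow> bool" where
  "is_limit \<delta> \<longleftrightarrow> (\<exists>\<alpha>. \<alpha> < \<delta>) \<and> (\<forall>\<alpha><\<delta>. \<exists>\<beta>. \<alpha> < \<beta> \<and> \<beta> < \<delta>)"

definition club :: "'a::wellorder set \<Rightarrow> bool" where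
  "club C \<longleftrightarrow>
     (\<forall>\<alpha>. \<exists>\<beta>\<in>C. \<alpha> < \<beta>) \<and>
     (\<forall>\<delta>. is_limit \<delta> \<and> (\<forall>\<alpha><\<delta>. \<exists>\<beta>\<in>C. \<alpha> < \<beta> \<and> \<beta> < \<delta>) \<longrightarrow> \<delta> \<in> C)"

text \<open>
  Ordinal addition restricted to \<open>\<lambda>\<close>, by \<open>\<delta> + \<alpha> = sup ({\<delta>} \<union> {(\<delta> + \<beta>) + 1 | \<beta> < \<alpha>})\<close>. The \<open>LEAST\<close>
  is attained if \<open>\<lambda>\<close> is an infinite regular cardinal; see \<open>oadd_ge\<close> and \<open>image_oadd\<close> below.
\<close>

function oadd :: "'a::wellorder \<Rightarrow> 'a \<Rightarrow> 'a" where
  "oadd \<delta> \<alpha> = (LEAST \<gamma>. \<delta> \<le> \<gamma> \<and> (\<forall>\<beta>\<in>{..<\<alpha>}. oadd \<delta> \<beta> < \<gamma>))"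
  by auto
termination
  by (relation "inv_image {(x, y). x < y} snd") (auto simp: wf)

declare oadd.simps [simp del]

subsection \<open>The space \<open>\<^sup>\<lambda>\<lambda>\<close> and its meagre ideal\<close>

text \<open>The set \<open>\<^sup><\<^sup>\<lambda>\<lambda>\<close>: a sequence of length \<open>\<alpha> < \<lambda>\<close> is a partial function with domain \<open>\<alpha>\<close>.\<close>

definition short_seqs :: "('a::wellorder \<rightharpoonup> 'a) set" where
  "short_seqs = {s. \<exists>\<alpha>. dom s = {..<\<alpha>}}"

definition basic_open :: "('a::wellorder \<rightharpoonup> 'a) \<Rightarrow> ('a \<Rightarrow> 'a) set" where
  "basic_open s = {f. s \<subseteq>\<^sub>m (\<lambda>\<alpha>. Some (f \<alpha>))}"

definition seq_topology :: "('a::wellorder \<Rightarrow> 'a) topology" where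
  "seq_topology = topology_generated_by (insert {} (basic_open ` short_seqs))"

definition nowhere_dense_in :: "'b topology \<Rightarrow> 'b set \<Rightarrow> bool" where
  "nowhere_dense_in X A \<longleftrightarrow> A \<subseteq> topspace X \<and> X interior_of (X closure_of A) = {}"

definition complete_ideal :: "'c rel \<Rightarrow> 'b set set \<Rightarrow> bool" where
  "complete_ideal \<kappa> I \<longleftrightarrow>
     {} \<in> I \<and>
     (\<forall>A\<in>I. \<forall>B\<subseteq>A. B \<in> I) \<and>
     (\<forall>F\<subseteq>I. |F| <o \<kappa> \<longrightarrow> \<Union>F \<in> I)"

definition meagre_ideal :: "('a::wellorder \<Rightarrow> 'a) set set" where
  "meagre_ideal =
     \<Inter>{I. complete_ideal (lam :: 'a rel) I \<and> {A. nowhere_dense_in seq_topology A} \<subseteq> I}"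

definition covering :: "'b set set \<Rightarrow> 'b set set \<Rightarrow> bool" where
  "covering I \<A> \<longleftrightarrow> \<A> \<subseteq> I \<and> \<Union>\<A> = UNIV"

text \<open>
  The cardinal of a covering of least size. Some covering exists as soon as \<open>I\<close> covers the space, and
  then so does one of least size; see \<open>cov_least\<close>.
\<close>

definition cov :: "'b set set \<Rightarrow> 'b set rel" where
  "cov I = |SOME \<A>. covering I \<A> \<and> (\<forall>\<B>. covering I \<B> \<longrightarrow> |\<A>| \<le>o |\<B>| )|"

subsection \<open>Ultrafilters\<close>

definition ultrafilter_on :: "'b set \<Rightarrow> 'b set set \<Rightarrow> bool" where
  "ultrafilter_on Z D \<longleftrightarrow>
     D \<subseteq> Pow Z \<and> Z \<in> D \<and> {} \<notin> D \<and>
     (\<forall>A\<in>D. \<forall>B. A \<subseteq> B \<and> B \<subseteq> Z \<longrightarrow> B \<in> D) \<and>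
     (\<forall>A\<in>D. \<forall>B\<in>D. A \<inter> B \<in> D) \<and>
     (\<forall>A\<subseteq>Z. A \<in> D \<or> Z - A \<in> D)"

definition uniform_ultrafilter :: "'a::wellorder set set \<Rightarrow> bool" where
  "uniform_ultrafilter D \<longleftrightarrow> ultrafilter_on UNIV D \<and> (\<forall>A\<in>D. |A| =o (lam :: 'a rel))"

subsection \<open>Reasonable ultrafilters\<close>

text \<open>
  A condition is a tuple \<open>(C, Z, d)\<close>; the families \<open>Z\<close> and \<open>d\<close> indexed by \<open>C\<close> are functions that are
  undefined outside \<open>C\<close>.
\<close>

type_synonym 'a condition = "'a set \<times> ('a \<Rightarrow> 'a set) \<times> ('a \<Rightarrow> 'a set set)"

definition Q0 :: "'a::wellorder condition set" where
  "Q0 = {(C, Z, d).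
     club C \<and> (\<forall>\<delta>\<in>C. is_limit \<delta>) \<and>
     Z \<in> extensional C \<and> d \<in> extensional C \<and>
     (\<forall>\<delta>\<in>C. Z \<delta> = {\<delta>..<(LEAST \<beta>. \<beta> \<in> C \<and> \<delta> < \<beta>)} \<and> ultrafilter_on (Z \<delta>) (d \<delta>))}"

definition fil :: "'a::wellorder condition \<Rightarrow> 'a set set" where
  "fil = (\<lambda>(C, Z, d). {A. \<exists>\<epsilon>. \<forall>\<delta>\<in>C. \<epsilon> \<le> \<delta> \<longrightarrow> A \<inter> Z \<delta> \<in> d \<delta>})"

definition fil_of_set :: "'a::wellorder condition set \<Rightarrow> 'a set set" where
  "fil_of_set G = (\<Union>p\<in>G. fil p)"

definition le0 :: "'a::wellorder condition \<Rightarrow> 'a condition \<Rightarrow> bool" (infix \<open>\<le>\<^sup>0\<close> 50) where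
  "p \<le>\<^sup>0 q \<longleftrightarrow> fil p \<subseteq> fil q"

text \<open>Being \<open>(<\<lambda>\<^sup>+)\<close>-directed: subsets of size at most \<open>\<lambda>\<close> have upper bounds.\<close>

definition directed_lam_plus :: "'a::wellorder condition set \<Rightarrow> bool" where
  "directed_lam_plus G \<longleftrightarrow>
     (\<forall>H\<subseteq>G. |H| \<le>o (lam :: 'a rel) \<longrightarrow> (\<exists>q\<in>G. \<forall>p\<in>H. p \<le>\<^sup>0 q))"

definition nondec_unbounded :: "('a::wellorder \<Rightarrow> 'a) set" where
  "nondec_unbounded = {f. mono f \<and> (\<forall>\<alpha>. \<exists>\<beta>. \<alpha> < f \<beta>)}"

definition weakly_reasonable :: "'a::wellorder set set \<Rightarrow> bool" where
  "weakly_reasonable D \<longleftrightarrow>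
     uniform_ultrafilter D \<and>
     (\<forall>f\<in>nondec_unbounded. \<exists>C. club C \<and> (\<Union>\<delta>\<in>C. {\<delta>..<oadd \<delta> (f \<delta>)}) \<notin> D)"

definition very_reasonable :: "'a::wellorder set set \<Rightarrow> bool" where
  "very_reasonable D \<longleftrightarrow>
     weakly_reasonable D \<and>
     (\<exists>G\<subseteq>Q0. directed_lam_plus G \<and> D = fil_of_set G)"

subsection \<open>Well-definedness of \<open>cov\<close> and \<open>oadd\<close>\<close>

lemma cov_least:
  assumes "covering I \<A>"
  shows "\<exists>\<B>. covering I \<B> \<and> cov I = |\<B>|" "cov I \<le>o |\<A>|"
proof -
  have "\<exists>r \<in> card_of ` Collect (covering I). \<forall>r' \<in> card_of ` Collect (covering I). r \<le>o r'"
    by (rule exists_minim_Card_order) (use assms in \<open>auto simp only: mem_Collect_eq card_of_Card_order image_iff image_is_empty\<close>)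
  then have "\<exists>\<A>. covering I \<A> \<and> (\<forall>\<B>. covering I \<B> \<longrightarrow> |\<A>| \<le>o |\<B>| )"
    by auto
  from someI_ex[OF this] assms
  show "\<exists>\<B>. covering I \<B> \<and> cov I = |\<B>|" "cov I \<le>o |\<A>|"
    unfolding cov_def by blast+
qed

context
  assumes lam_card: "card_order (lam :: 'a::wellorder rel)"
    and lam_reg: "regularCard (lam :: 'a rel)"
    and lam_unc: "natLeq <o (lam :: 'a rel)"
begin

private lemma Field_lam: "Field (lam :: 'a rel) = UNIV"
  by (auto simp: lam_def Field_def)

private lemma small_bounded:
  fixes K :: "'a set"
  assumes "|K| <o (lam :: 'a rel)"
  shows "\<exists>\<gamma>. \<forall>\<beta>\<in>K. \<beta> < \<gamma>"
proof -
  have "\<not> cofinal K (lam :: 'a rel)"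
    using lam_reg assms Field_lam not_ordLess_ordIso unfolding regularCard_def by blast
  then obtain \<gamma> where "\<forall>\<beta>\<in>K. \<not> (\<gamma> \<noteq> \<beta> \<and> \<gamma> \<le> \<beta>)"
    unfolding cofinal_def Field_lam by (auto simp: lam_def)
  then have *: "\<forall>\<beta>\<in>K. \<beta> \<le> \<gamma>" by force
  have "infinite (UNIV :: 'a set)"
    using lam_unc lam_card Field_lam ordLess_imp_ordLeq infinite_iff_natLeq_ordLeq
    by (metis card_of_unique ordLeq_ordIso_trans)
  then have "Cinfinite (lam :: 'a rel)"
    using lam_card by (auto simp: cinfinite_def Field_lam)
  from Cinfinite_limit[OF _ this, of \<gamma>] Field_lam
  have "\<exists>\<gamma>'. \<gamma> \<noteq> \<gamma>' \<and> (\<gamma>, \<gamma>') \<in> (lam :: 'a rel)" by auto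
  then obtain \<gamma>' where "\<gamma> < \<gamma>'" by (auto simp: lam_def less_le)
  then show ?thesis using * by (meson le_less_trans)
qed

private lemma oadd_props:
  fixes \<delta> \<alpha> :: 'a
  shows "\<delta> \<le> oadd \<delta> \<alpha> \<and> (\<forall>\<beta>\<in>{..<\<alpha>}. oadd \<delta> \<beta> < oadd \<delta> \<alpha>)"
proof -
  have "|{..<\<alpha>}| <o (lam :: 'a rel)"
  proof -
    have "{..<\<alpha>} = underS lam \<alpha>" by (auto simp: underS_def lam_def)
    moreover have "Card_order (lam :: 'a rel)"
      using lam_card Field_lam by simp
    ultimately show ?thesis
      using card_of_underS Field_lam by (metis UNIV_I)
  qed
  then have "|insert \<delta> (oadd \<delta> ` {..<\<alpha>})| <o (lam :: 'a rel)"
  proof -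
    assume a: "|{..<\<alpha>}| <o (lam :: 'a rel)"
    have b: "|oadd \<delta> ` {..<\<alpha>}| <o (lam :: 'a rel)"
      using a card_of_image ordLeq_ordLess_trans by blast
    have c: "|{\<delta>}| <o (lam :: 'a rel)"
      using lam_unc finite_iff_ordLess_natLeq[of "{\<delta>}"] ordLess_transitive by blast
    have "|{\<delta>} \<union> oadd \<delta> ` {..<\<alpha>}| <o (lam :: 'a rel)"
      using card_of_Un_ordLess_infinite_Field[OF _ _ c b] lam_card Field_lam lam_unc
      by (metis card_of_unique infinite_iff_natLeq_ordLeq ordLeq_ordIso_trans ordLess_imp_ordLeq)
    then show ?thesis by simp
  qed
  from small_bounded[OF this] obtain \<gamma>
    where "\<delta> \<le> \<gamma> \<and> (\<forall>\<beta>\<in>{..<\<alpha>}. oadd \<delta> \<beta> < \<gamma>)"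
    by (meson imageI insertCI less_imp_le)
  from LeastI[of "\<lambda>\<gamma>. \<delta> \<le> \<gamma> \<and> (\<forall>\<beta>\<in>{..<\<alpha>}. oadd \<delta> \<beta> < \<gamma>)", OF this]
  show ?thesis unfolding oadd.simps[of \<delta> \<alpha>, symmetric] .
qed

lemma oadd_ge: "\<delta> \<le> oadd \<delta> \<alpha>" for \<delta> \<alpha> :: 'a
  using oadd_props by blast

lemma oadd_strict_mono: "strict_mono (oadd \<delta>)" for \<delta> :: 'a
  using oadd_props by (auto intro: strict_monoI)

lemma image_oadd: "oadd \<delta> ` {..<\<alpha>} = {\<delta>..<oadd \<delta> \<alpha>}" for \<delta> \<alpha> :: 'a
proof (intro equalityI subsetI)
  fix x assume "x \<in> {\<delta>..<oadd \<delta> \<alpha>}"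
  then have x: "\<delta> \<le> x" "x < oadd \<delta> \<alpha>" by auto
  define \<beta> where "\<beta> = (LEAST \<beta>. x \<le> oadd \<delta> \<beta>)"
  have 1: "x \<le> oadd \<delta> \<beta>"
    unfolding \<beta>_def by (rule LeastI[of _ \<alpha>]) (use x in auto)
  have "\<forall>\<gamma>\<in>{..<\<beta>}. oadd \<delta> \<gamma> < x"
    unfolding \<beta>_def using not_less_Least[of _ "\<lambda>\<beta>. x \<le> oadd \<delta> \<beta>"] by (auto simp: not_le)
  then have "oadd \<delta> \<beta> \<le> x"
    unfolding oadd.simps[of \<delta> \<beta>] by (intro Least_le) (use x in auto)
  with 1 have "x = oadd \<delta> \<beta>" by simp
  with x(2) show "x \<in> oadd \<delta> ` {..<\<alpha>}"
    using strict_mono_less[OF oadd_strict_mono] by auto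
qed (use oadd_props oadd_ge in auto)

end

end

theory Submission
  imports Defs
begin

text \<open>
  Build conditions \<open>r\<^sub>\<alpha>\<close> for \<open>\<alpha> < 2\<^sup>\<lambda>\<close> so that any finitely many of them have common limits beyond each
  \<open>\<epsilon> < \<lambda>\<close>: an ultrafilter \<open>e\<close> on some \<open>[\<epsilon>, \<zeta>)\<close>, \<open>\<zeta> < \<lambda>\<close>, in the closure of \<open>{d\<^sub>\<delta> : \<delta> \<ge> \<epsilon>}\<close> for each of
  them. As \<open>\<lambda>\<close> is regular, compactness extends this from finitely many to fewer than \<open>\<lambda>\<close> conditions,
  so a diagonal choice of limits bounds any \<open>\<lambda>\<close> of them. To keep the bound compatible with all fewer
  than \<open>2\<^sup>\<lambda>\<close> conditions constructed before, the limits are read off from a point of \<open>\<^sup>\<lambda>\<lambda>\<close> outside fewer than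
  \<open>2\<^sup>\<lambda>\<close> nowhere dense sets. The same step decides a given set \<open>A\<close>, and it treats a given \<open>f\<close> by taking
  the limit chosen at \<open>\<delta>\<close> beyond \<open>\<delta> + f \<delta>\<close>.
\<close>

subsection \<open>Ultrafilters and their limits\<close>

text \<open>Zorn's lemma gives a maximal proper filter \<open>M\<close> above \<open>B\<close>. If
  \<open>M\<close> left some \<open>A\<close> undecided, adjoining \<open>A\<close> would yield a
  strictly larger proper filter.\<close>

lemma ultrafilter_extends:
  assumes U: "UNIV \<in> B" and E: "{} \<notin> B"
    and up: "\<And>A C. A \<in> B \<Longrightarrow> A \<subseteq> C \<Longrightarrow> C \<in> B"
    and int: "\<And>A C. A \<in> B \<Longrightarrow> C \<in> B \<Longrightarrow> A \<inter> C \<in> B"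
  shows "\<exists>e. ultrafilter_on UNIV e \<and> B \<subseteq> e"
proof -
  define \<Phi> where "\<Phi> = {F. B \<subseteq> F \<and> {} \<notin> F \<and> (\<forall>A\<in>F. \<forall>C. A \<subseteq> C \<longrightarrow> C \<in> F) \<and> (\<forall>A\<in>F. \<forall>C\<in>F. A \<inter> C \<in> F)}"
  have "\<exists>M\<in>\<Phi>. \<forall>X\<in>\<Phi>. M \<subseteq> X \<longrightarrow> X = M"
  proof (rule subset_Zorn_nonempty)
    have "B \<in> \<Phi>" using assms unfolding \<Phi>_def by blast
    then show "\<Phi> \<noteq> {}" by blast
  next
    fix \<C> assume ne: "\<C> \<noteq> {}" and ch: "subset.chain \<Phi> \<C>"
    have sub: "\<C> \<subseteq> \<Phi>" and lin: "\<And>X Y. X \<in> \<C> \<Longrightarrow> Y \<in> \<C> \<Longrightarrow> X \<subseteq> Y \<or> Y \<subseteq> X"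
      using ch unfolding subset_chain_def by blast+
    have "A \<inter> C \<in> \<Union>\<C>" if "A \<in> \<Union>\<C>" "C \<in> \<Union>\<C>" for A C
    proof -
      from that obtain X Y where XY: "X \<in> \<C>" "Y \<in> \<C>" "A \<in> X" "C \<in> Y" by blast
      then obtain V where "V \<in> \<C>" "A \<in> V" "C \<in> V" using lin[OF XY(1,2)] by blast
      then show ?thesis using sub unfolding \<Phi>_def by blast
    qed
    moreover have "B \<subseteq> \<Union>\<C>" using ne sub unfolding \<Phi>_def by blast
    moreover have "{} \<notin> \<Union>\<C>" using sub unfolding \<Phi>_def by blast
    moreover have "C \<in> \<Union>\<C>" if "A \<in> \<Union>\<C>" "A \<subseteq> C" for A C
      using that sub unfolding \<Phi>_def by blast
    ultimately show "\<Union>\<C> \<in> \<Phi>" unfolding \<Phi>_def mem_Collect_eq by metis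
  qed
  then obtain M where M: "M \<in> \<Phi>" and max: "\<And>X. X \<in> \<Phi> \<Longrightarrow> M \<subseteq> X \<Longrightarrow> X = M" by blast
  have BM: "B \<subseteq> M" and EM: "{} \<notin> M" and upM: "\<And>A C. A \<in> M \<Longrightarrow> A \<subseteq> C \<Longrightarrow> C \<in> M"
    and intM: "\<And>A C. A \<in> M \<Longrightarrow> C \<in> M \<Longrightarrow> A \<inter> C \<in> M"
    using M unfolding \<Phi>_def by blast+
  have "A \<in> M \<or> - A \<in> M" for A
  proof (rule ccontr)
    assume n: "\<not> (A \<in> M \<or> - A \<in> M)"
    let ?X = "{C. \<exists>V\<in>M. V \<inter> A \<subseteq> C}"
    have "{} \<notin> ?X" using n upM by (auto simp: Int_commute disjoint_eq_subset_Compl)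
    moreover have "B \<subseteq> ?X" using BM by blast
    moreover have "\<forall>C\<in>?X. \<forall>D. C \<subseteq> D \<longrightarrow> D \<in> ?X" by blast
    moreover have "\<forall>C\<in>?X. \<forall>D\<in>?X. C \<inter> D \<in> ?X"
    proof (intro ballI)
      fix C D assume "C \<in> ?X" "D \<in> ?X"
      then obtain V W where "V \<in> M" "W \<in> M" "V \<inter> A \<subseteq> C" "W \<inter> A \<subseteq> D" by blast
      then have "V \<inter> W \<in> M" "V \<inter> W \<inter> A \<subseteq> C \<inter> D" using intM by blast+
      then show "C \<inter> D \<in> ?X" by blast
    qed
    ultimately have "?X \<in> \<Phi>" unfolding \<Phi>_def by blast
    then have "?X = M" by (rule max) blast
    moreover have "A \<in> ?X" using U BM by blast
    ultimately show False using n by blast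
  qed
  then have "ultrafilter_on UNIV M"
    unfolding ultrafilter_on_def using U BM EM upM intM by (auto simp: Compl_eq_Diff_UNIV)
  then show ?thesis using BM by blast
qed

lemma ultrafilter_onD:
  assumes "ultrafilter_on UNIV e"
  shows "{} \<notin> e" "UNIV \<in> e" "A \<in> e \<Longrightarrow> A \<subseteq> B \<Longrightarrow> B \<in> e" "A \<in> e \<Longrightarrow> B \<in> e \<Longrightarrow> A \<inter> B \<in> e"
    "A \<in> e \<or> - A \<in> e" "A \<in> e \<Longrightarrow> - A \<notin> e"
proof -
  have e: "{} \<notin> e" "\<And>A B. A \<in> e \<Longrightarrow> B \<in> e \<Longrightarrow> A \<inter> B \<in> e"
    using assms unfolding ultrafilter_on_def by blast+
  show "{} \<notin> e" "UNIV \<in> e" "A \<in> e \<Longrightarrow> A \<subseteq> B \<Longrightarrow> B \<in> e" "A \<in> e \<Longrightarrow> B \<in> e \<Longrightarrow> A \<inter> B \<in> e"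
    "A \<in> e \<or> - A \<in> e"
    using assms unfolding ultrafilter_on_def by (auto simp: Compl_eq_Diff_UNIV)
  show "A \<in> e \<Longrightarrow> - A \<notin> e" using e(1) e(2)[of A "- A"] by auto
qed

lemma ultrafilter_principal: "ultrafilter_on UNIV {A. x \<in> A}"
  unfolding ultrafilter_on_def by auto

text \<open>Directed by inclusion and fewer than \<lambda> in number, these sets index the nets
  whose limits are taken.\<close>

definition fin_below :: "'a::wellorder \<Rightarrow> 'a set set" where
  "fin_below \<xi> = {F. finite F \<and> F \<subseteq> {..<\<xi>}}"

text \<open>When \<open>e\<close> and all \<open>v F\<close> are ultrafilters, this says that
  \<open>e\<close> is a cluster point of the net \<open>v\<close> in the Stone space.\<close>

definition is_limit_of :: "'a::wellorder \<Rightarrow> ('a set \<Rightarrow> 'b set set) \<Rightarrow> 'b set set \<Rightarrow> bool" where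
  "is_limit_of \<xi> v e \<longleftrightarrow>
     (\<forall>A. (\<exists>F\<in>fin_below \<xi>. \<forall>F'\<in>fin_below \<xi>. F \<subseteq> F' \<longrightarrow> A \<in> v F') \<longrightarrow> A \<in> e)"

lemma is_limit_ofD:
  "is_limit_of \<xi> v e \<Longrightarrow> F \<in> fin_below \<xi> \<Longrightarrow> (\<And>F'. F' \<in> fin_below \<xi> \<Longrightarrow> F \<subseteq> F' \<Longrightarrow> A \<in> v F') \<Longrightarrow> A \<in> e"
  unfolding is_limit_of_def by blast

text \<open>Compactness of the Stone space: the sets that lie in \<open>v F\<close> for all large
  \<open>F\<close> form a proper filter, and any ultrafilter above it will do.\<close>

lemma ultrafilter_limit_exists:
  assumes "\<And>F. F \<in> fin_below \<xi> \<Longrightarrow> ultrafilter_on UNIV (v F)"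
  shows "\<exists>e. ultrafilter_on UNIV e \<and> is_limit_of \<xi> v e"
proof -
  let ?B = "{A. \<exists>F\<in>fin_below \<xi>. \<forall>F'\<in>fin_below \<xi>. F \<subseteq> F' \<longrightarrow> A \<in> v F'}"
  have emp: "{} \<in> fin_below \<xi>" unfolding fin_below_def by auto
  have "\<exists>e. ultrafilter_on UNIV e \<and> ?B \<subseteq> e"
  proof (rule ultrafilter_extends)
    show "UNIV \<in> ?B" using emp ultrafilter_onD(2)[OF assms] by blast
    show "{} \<notin> ?B" using ultrafilter_onD(1)[OF assms] by blast
    show "C \<in> ?B" if "A \<in> ?B" "A \<subseteq> C" for A C
    proof -
      from that(1) obtain F where "F \<in> fin_below \<xi>" "\<forall>F'\<in>fin_below \<xi>. F \<subseteq> F' \<longrightarrow> A \<in> v F'"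
        by blast
      then show ?thesis using ultrafilter_onD(3)[OF assms] that(2) by blast
    qed
  next
    fix A C assume "A \<in> ?B" "C \<in> ?B"
    then obtain F K where FK: "F \<in> fin_below \<xi>" "K \<in> fin_below \<xi>"
      "\<forall>F'\<in>fin_below \<xi>. F \<subseteq> F' \<longrightarrow> A \<in> v F'" "\<forall>F'\<in>fin_below \<xi>. K \<subseteq> F' \<longrightarrow> C \<in> v F'" by blast
    have "F \<union> K \<in> fin_below \<xi>" using FK unfolding fin_below_def by blast
    moreover have "A \<inter> C \<in> v F'" if "F' \<in> fin_below \<xi>" "F \<union> K \<subseteq> F'" for F'
      using FK(3,4) that by (intro ultrafilter_onD(4)[OF assms]) auto
    ultimately show "A \<inter> C \<in> ?B" by blast
  qed
  then show ?thesis unfolding is_limit_of_def by blast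
qed

subsection \<open>Cardinal arithmetic\<close>

lemma finite_ordLess_infinite_card_of: "finite A \<Longrightarrow> infinite B \<Longrightarrow> |A| <o |B|"
  using card_of_ordLeq_finite by (metis card_of_Well_order not_ordLess_iff_ordLeq)

lemma card_of_finite_subsets:
  assumes "infinite A"
  shows "|{F. finite F \<and> F \<subseteq> A}| \<le>o |A|"
proof -
  have *: "|{F. finite F \<and> F \<subseteq> A \<and> card F = n}| \<le>o |A|" for n
  proof (induction n)
    case 0
    have "{F. finite F \<and> F \<subseteq> A \<and> card F = 0} = {{}}" by auto
    then show ?case using assms by (metis card_of_singl_ordLeq finite.emptyI)
  next
    case (Suc n)
    let ?T = "{F. finite F \<and> F \<subseteq> A \<and> card F = n}"
    have "{F. finite F \<and> F \<subseteq> A \<and> card F = Suc n} \<subseteq> (\<lambda>(x, F). insert x F) ` (A \<times> ?T)"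
    proof
      fix F assume F: "F \<in> {F. finite F \<and> F \<subseteq> A \<and> card F = Suc n}"
      then obtain x G where "F = insert x G" "x \<notin> G" "card G = n" "finite G"
        by (auto simp: card_Suc_eq_finite)
      with F show "F \<in> (\<lambda>(x, F). insert x F) ` (A \<times> ?T)" by (auto simp: image_iff)
    qed
    then have "|{F. finite F \<and> F \<subseteq> A \<and> card F = Suc n}| \<le>o |A \<times> ?T|"
      by (meson card_of_image card_of_mono1 ordLeq_transitive)
    also have "|A \<times> ?T| \<le>o |A|"
      by (rule card_of_Times_ordLeq_infinite_Field)
        (use assms Suc in \<open>simp_all only: Field_card_of card_of_Card_order card_of_refl card_of_card_order_on ordIso_imp_ordLeq not_False_eq_True\<close>)
    finally show ?case .
  qed
  have "|\<Union>n\<in>(UNIV :: nat set). {F. finite F \<and> F \<subseteq> A \<and> card F = n}| \<le>o |A|"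
    by (rule card_of_UNION_ordLeq_infinite) (use assms * infinite_iff_card_of_nat in auto)
  moreover have "(\<Union>n\<in>(UNIV :: nat set). {F. finite F \<and> F \<subseteq> A \<and> card F = n}) = {F. finite F \<and> F \<subseteq> A}"
    by auto
  ultimately show ?thesis by simp
qed

lemma finite_subsets_ordLess:
  assumes "infinite (UNIV :: 'c set)" "|A| <o |UNIV :: 'c set|"
  shows "|{F. finite F \<and> F \<subseteq> A}| <o |UNIV :: 'c set|"
proof (cases "finite A")
  case True
  then have "finite {F. finite F \<and> F \<subseteq> A}" by simp
  then show ?thesis using assms(1) by (simp add: finite_ordLess_infinite_card_of)
next
  case False
  then show ?thesis using card_of_finite_subsets assms(2) ordLeq_ordLess_trans by blast
qed

lemma Times_ordLess:
  assumes "infinite C" "|A| <o |C|" "|B| <o |C|"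
  shows "|A \<times> B| <o |C|"
proof (cases "finite (A <+> B)")
  case True
  then have "finite (A \<times> B)" by simp
  then show ?thesis using finite_ordLess_infinite_card_of assms(1) by blast
next
  case False
  have "(\<lambda>(x, y). (Inl x, Inr y)) ` (A \<times> B) \<subseteq> (A <+> B) \<times> (A <+> B)" by auto
  moreover have "inj_on (\<lambda>(x, y). (Inl x, Inr y)) (A \<times> B)" by (auto intro: inj_onI)
  ultimately have "|A \<times> B| \<le>o |(A <+> B) \<times> (A <+> B)|" using card_of_ordLeq by blast
  also have "|(A <+> B) \<times> (A <+> B)| =o |A <+> B|" by (rule card_of_Times_same_infinite[OF False])
  also have "|A <+> B| <o |C|" by (rule card_of_Plus_ordLess_infinite[OF assms])
  finally show ?thesis .
qed

lemma infinite_pairing: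
  assumes "infinite (UNIV :: 'c set)"
  shows "\<exists>h :: 'c \<Rightarrow> 'c \<times> 'c. surj h"
  using card_of_Times_same_infinite[OF assms] card_of_ordLeq2[of "UNIV :: ('c \<times> 'c) set" "UNIV :: 'c set"]
  by (auto simp: ordIso_iff_ordLeq)

subsection \<open>Regularity\<close>

context
  assumes lam_card: "card_order (lam :: 'a::wellorder rel)"
    and lam_reg: "regularCard (lam :: 'a rel)"
    and lam_unc: "natLeq <o (lam :: 'a rel)"
begin

lemma Field_lam: "Field (lam :: 'a rel) = UNIV"
  by (auto simp: lam_def Field_def)

lemma lam_ordIso: "(lam :: 'a rel) =o |UNIV :: 'a set|"
  using lam_card by (rule card_of_unique)

lemma infinite_lam: "infinite (UNIV :: 'a set)"
  using lam_unc lam_ordIso by (metis infinite_iff_natLeq_ordLeq ordLeq_ordIso_trans ordLess_imp_ordLeq)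

lemma ordLess_lessThan: "|{..<\<alpha>}| <o |UNIV :: 'a set|" for \<alpha> :: 'a
proof -
  have "{..<\<alpha>} = underS lam \<alpha>" by (auto simp: underS_def lam_def)
  moreover have "Card_order (lam :: 'a rel)"
    using lam_card Field_lam by simp
  ultimately show ?thesis
    using card_of_underS Field_lam lam_ordIso by (metis UNIV_I ordLess_ordIso_trans)
qed

lemma small_bounded:
  fixes K :: "'a set"
  assumes "|K| <o |UNIV :: 'a set|"
  shows "\<exists>\<gamma>. K \<subseteq> {..<\<gamma>}"
proof -
  have "|K| <o (lam :: 'a rel)" using assms lam_ordIso ordIso_symmetric ordLess_ordIso_trans by blast
  then have "\<not> cofinal K (lam :: 'a rel)"
    using lam_reg Field_lam not_ordLess_ordIso unfolding regularCard_def by blast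
  then obtain \<gamma> where "\<forall>\<beta>\<in>K. \<not> (\<gamma> \<noteq> \<beta> \<and> \<gamma> \<le> \<beta>)"
    unfolding cofinal_def Field_lam by (auto simp: lam_def)
  then have *: "\<forall>\<beta>\<in>K. \<beta> \<le> \<gamma>" by force
  have "Cinfinite (lam :: 'a rel)"
    using lam_card infinite_lam by (auto simp: cinfinite_def Field_lam)
  from Cinfinite_limit[OF _ this, of \<gamma>] Field_lam
  obtain \<gamma>' where "\<gamma> < \<gamma>'" by (auto simp: lam_def less_le)
  then have "K \<subseteq> {..<\<gamma>'}" using * by (auto intro: le_less_trans)
  then show ?thesis ..
qed

lemma small_image_bounded:
  fixes f :: "'b \<Rightarrow> 'a"
  assumes "|K| <o |UNIV :: 'a set|"
  shows "\<exists>\<gamma>. \<forall>x\<in>K. f x < \<gamma>"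
proof -
  have "|f ` K| <o |UNIV :: 'a set|" using assms card_of_image ordLeq_ordLess_trans by blast
  then show ?thesis using small_bounded[of "f ` K"] by auto
qed

lemma unbounded_ordIso:
  fixes K :: "'a set"
  assumes "\<And>\<alpha>. \<exists>\<beta>\<in>K. \<alpha> \<le> \<beta>"
  shows "|K| =o (lam :: 'a rel)"
proof -
  have "\<not> |K| <o |UNIV :: 'a set|"
    using small_bounded[of K] assms by (metis lessThan_iff linorder_not_less subset_iff)
  then have "|K| =o |UNIV :: 'a set|"
    using card_of_mono1[OF subset_UNIV, of K] ordLeq_iff_ordLess_or_ordIso by blast
  then show ?thesis using lam_ordIso ordIso_symmetric ordIso_transitive by blast
qed

text \<open>\<open>\<xi>\<close> has fewer than \<lambda> finite subsets, so regularity applies.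
  This gives the members of a net of bounded ultrafilters one common bound.\<close>

lemma fin_below_bounded:
  fixes f :: "'a set \<Rightarrow> 'a"
  shows "\<exists>\<gamma>. \<forall>F\<in>fin_below \<xi>. f F < \<gamma>"
  by (rule small_image_bounded)
    (auto simp: fin_below_def intro: finite_subsets_ordLess[OF infinite_lam ordLess_lessThan])

lemma greater_exists: "\<exists>\<beta>. \<alpha> < \<beta>" for \<alpha> :: 'a
  using small_bounded[of "{\<alpha>}"] finite_ordLess_infinite_card_of[OF _ infinite_lam, of "{\<alpha>}"] by auto

text \<open>If \<open>z \<xi>\<close> bounds the ultrafilter chosen at \<open>\<xi>\<close>, each of
  these points lies at or beyond the bounds of all earlier choices, so the intervals between
  consecutive points are long enough.\<close>

lemma club_closure_points:
  fixes z :: "'a \<Rightarrow> 'a"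
  shows "club {\<delta>. is_limit \<delta> \<and> (\<forall>\<xi><\<delta>. z \<xi> \<le> \<delta>)}" (is "club ?C")
  unfolding club_def
proof (intro conjI allI impI)
  fix \<alpha> :: 'a
  have "\<exists>\<gamma>. \<beta> < \<gamma> \<and> (\<forall>\<xi><\<beta>. z \<xi> < \<gamma>)" for \<beta> :: 'a
  proof -
    obtain \<gamma> where "\<forall>x\<in>{..<\<beta>}. z x < \<gamma>" using small_image_bounded[OF ordLess_lessThan] by blast
    moreover obtain \<gamma>' where "\<beta> < \<gamma>'" using greater_exists by blast
    ultimately show ?thesis by (intro exI[of _ "max \<gamma> \<gamma>'"]) (auto simp: less_max_iff_disj)
  qed
  then obtain N where N: "\<And>\<beta>. \<beta> < N \<beta>" "\<And>\<beta> \<xi>. \<xi> < \<beta> \<Longrightarrow> z \<xi> < N \<beta>" by metis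
  define s where "s n = (N ^^ n) \<alpha>" for n
  have s: "s 0 = \<alpha>" "s (Suc n) = N (s n)" for n unfolding s_def by auto
  \<comment> \<open>The supremum of the \<omega> iterates of \<open>N\<close> is a closure point; it
    is below \<lambda> because \<lambda> is regular and uncountable.\<close>
  have "|UNIV :: nat set| <o |UNIV :: 'a set|"
    using lam_unc lam_ordIso card_of_nat ordIso_ordLess_trans ordLess_ordIso_trans by blast
  from small_image_bounded[OF this] have ex: "\<exists>\<gamma>. \<forall>n. s n < \<gamma>" by auto
  define \<delta> where "\<delta> = (LEAST \<gamma>. \<forall>n. s n < \<gamma>)"
  have \<delta>: "s n < \<delta>" for n using LeastI_ex[OF ex] unfolding \<delta>_def by blast
  have below: "\<exists>n. \<beta> \<le> s n" if "\<beta> < \<delta>" for \<beta>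
    using not_less_Least[of \<beta> "\<lambda>\<gamma>. \<forall>n. s n < \<gamma>"] that unfolding \<delta>_def by (auto simp: not_less)
  have "is_limit \<delta>" unfolding is_limit_def
    using \<delta> below N(1) s(2) by (metis le_less_trans)
  moreover have "z \<xi> \<le> \<delta>" if "\<xi> < \<delta>" for \<xi>
  proof -
    from below[OF that] obtain n where "\<xi> \<le> s n" by blast
    then have "\<xi> < s (Suc n)" using N(1) s(2) by (metis le_less_trans)
    then have "z \<xi> < s (Suc (Suc n))" using N(2) s(2) by metis
    then show ?thesis using \<delta> less_imp_le less_trans by blast
  qed
  ultimately show "\<exists>\<beta>\<in>?C. \<alpha> < \<beta>" using \<delta>[of 0] s(1) by auto
next
  fix \<delta> assume "is_limit \<delta> \<and> (\<forall>\<alpha><\<delta>. \<exists>\<beta>\<in>?C. \<alpha> < \<beta> \<and> \<beta> < \<delta>)"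
  then have \<delta>: "is_limit \<delta>" "\<And>\<xi>. \<xi> < \<delta> \<Longrightarrow> \<exists>\<beta>\<in>?C. \<xi> < \<beta> \<and> \<beta> < \<delta>" by blast+
  have "z \<xi> \<le> \<delta>" if "\<xi> < \<delta>" for \<xi>
  proof -
    from \<delta>(2)[OF that] obtain \<beta> where "\<beta> \<in> ?C" "\<xi> < \<beta>" "\<beta> < \<delta>" by blast
    then have "z \<xi> \<le> \<beta>" by blast
    then show ?thesis using \<open>\<beta> < \<delta>\<close> by order
  qed
  then show "\<delta> \<in> ?C" using \<delta>(1) by blast
qed

end

subsection \<open>Nowhere dense sets\<close>

text \<open>Of two initial segments of \<open>x\<close> one extends the other, so the longer one
  handles a binary intersection.\<close>

lemma open_contains_basic:
  fixes V :: "('a::wellorder \<Rightarrow> 'a) set"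
  assumes "openin seq_topology V" "x \<in> V"
  shows "\<exists>\<alpha>. \<forall>y. (\<forall>\<xi><\<alpha>. y \<xi> = x \<xi>) \<longrightarrow> y \<in> V"
proof -
  have "generate_topology_on (insert {} (basic_open ` short_seqs)) V"
    using assms(1) unfolding seq_topology_def openin_topology_generated_by_iff .
  then show ?thesis using assms(2)
  proof (induction arbitrary: x rule: generate_topology_on.induct)
    case (Int a b)
    from Int.IH(1)[of x] Int.prems obtain \<alpha> where a: "\<forall>y. (\<forall>\<xi><\<alpha>. y \<xi> = x \<xi>) \<longrightarrow> y \<in> a" by blast
    from Int.IH(2)[of x] Int.prems obtain \<beta> where b: "\<forall>y. (\<forall>\<xi><\<beta>. y \<xi> = x \<xi>) \<longrightarrow> y \<in> b" by blast
    show ?case using a b by (intro exI[of _ "max \<alpha> \<beta>"]) (auto simp: less_max_iff_disj)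
  next
    case (Basis V)
    then obtain s \<alpha> where V: "V = basic_open s" and s: "dom s = {..<\<alpha>}"
      unfolding short_seqs_def by auto
    show ?case
    proof (intro exI[of _ \<alpha>] allI impI)
      fix y :: "'a \<Rightarrow> 'a" assume y: "\<forall>\<xi><\<alpha>. y \<xi> = x \<xi>"
      have "\<forall>\<xi>\<in>{..<\<alpha>}. s \<xi> = Some (x \<xi>)"
        using Basis(2) unfolding V basic_open_def map_le_def s by simp
      then show "y \<in> V" using y unfolding V basic_open_def map_le_def s by simp
    qed
  next
    case (UN K)
    from UN.prems obtain V where V: "V \<in> K" "x \<in> V" by (rule UnionE)
    from UN.IH[OF V] obtain \<alpha> where "\<forall>y. (\<forall>\<xi><\<alpha>. y \<xi> = x \<xi>) \<longrightarrow> y \<in> V" ..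
    with V(1) show ?case by (intro exI[of _ \<alpha>]) (auto intro: UnionI[of V])
  qed simp
qed

lemma openin_agree:
  fixes x :: "'a::wellorder \<Rightarrow> 'a"
  shows "openin seq_topology {y. \<forall>\<xi><\<alpha>. y \<xi> = x \<xi>}"
proof -
  let ?s = "\<lambda>\<xi>. if \<xi> < \<alpha> then Some (x \<xi>) else None"
  have "?s \<in> short_seqs" unfolding short_seqs_def by (auto simp: dom_def split: if_splits)
  moreover have "{y. \<forall>\<xi><\<alpha>. y \<xi> = x \<xi>} = basic_open ?s"
    unfolding basic_open_def map_le_def by (auto simp: dom_def split: if_splits)
  ultimately show ?thesis
    unfolding seq_topology_def openin_topology_generated_by_iff
    by (auto intro: generate_topology_on.Basis)
qed

text \<open>A nonempty open set contains all extensions of some initial segment of one of its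
  points. A further extension whose basic open set misses \<open>A\<close> keeps it from lying in
  the closure of \<open>A\<close>.\<close>

lemma nowhere_dense_criterion:
  fixes A :: "('a::wellorder \<Rightarrow> 'a) set"
  assumes "\<And>x \<alpha>. \<exists>y \<beta>. \<alpha> \<le> \<beta> \<and> (\<forall>\<xi><\<alpha>. y \<xi> = x \<xi>) \<and> (\<forall>w. (\<forall>\<xi><\<beta>. w \<xi> = y \<xi>) \<longrightarrow> w \<notin> A)"
  shows "nowhere_dense_in seq_topology A"
proof -
  \<comment> \<open>Nothing lies below the least ordinal, so this basic open set is the whole space,
    which identifies \<open>topspace\<close>.\<close>
  have eq: "{y :: 'a \<Rightarrow> 'a. \<forall>\<xi><(LEAST \<gamma>. True). y \<xi> = undefined} = UNIV"
    using not_less_Least[of _ "\<lambda>_. True"] by auto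
  have "openin seq_topology (UNIV :: ('a \<Rightarrow> 'a) set)"
    using openin_agree[of "LEAST \<gamma>. True" "\<lambda>_ :: 'a. undefined :: 'a"] unfolding eq .
  then have top: "topspace seq_topology = (UNIV :: ('a \<Rightarrow> 'a) set)"
    using openin_subset by auto
  have "seq_topology interior_of (seq_topology closure_of A) = {}"
  proof (rule ccontr)
    assume "\<not> ?thesis"
    then obtain V x where V: "openin seq_topology V" "x \<in> V" "V \<subseteq> seq_topology closure_of A"
      unfolding interior_of_def by blast
    from open_contains_basic[OF V(1,2)] obtain \<alpha> where \<alpha>: "\<forall>y. (\<forall>\<xi><\<alpha>. y \<xi> = x \<xi>) \<longrightarrow> y \<in> V" by blast
    from assms[where x = x and \<alpha> = \<alpha>] obtain y \<beta> where y: "\<alpha> \<le> \<beta>" "\<forall>\<xi><\<alpha>. y \<xi> = x \<xi>" "\<forall>w. (\<forall>\<xi><\<beta>. w \<xi> = y \<xi>) \<longrightarrow> w \<notin> A"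
      by blast
    have "y \<in> seq_topology closure_of A" using \<alpha> y(2) V(3) by blast
    moreover have "y \<in> {w. \<forall>\<xi><\<beta>. w \<xi> = y \<xi>}" by simp
    ultimately have "\<exists>w. w \<in> A \<and> w \<in> {w. \<forall>\<xi><\<beta>. w \<xi> = y \<xi>}"
      using openin_agree[of \<beta> y] unfolding in_closure_of by (elim conjE allE impE) (rule conjI)
    then obtain w where "w \<in> A" "\<forall>\<xi><\<beta>. w \<xi> = y \<xi>" by auto
    then show False using y(3) by blast
  qed
  then show ?thesis unfolding nowhere_dense_in_def top by simp
qed

text \<open>Nowhere dense sets belong to the ideal, so such a family, if it covered the space, would
  compete in the minimum that defines \<open>cov\<close>.\<close>

lemma nowhere_dense_family_not_covering:
  fixes \<A> :: "('a::wellorder \<Rightarrow> 'a) set set"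
  assumes "\<And>A. A \<in> \<A> \<Longrightarrow> nowhere_dense_in seq_topology A"
    and "|\<A>| <o cov (meagre_ideal :: ('a \<Rightarrow> 'a) set set)"
  shows "\<exists>x. x \<notin> \<Union>\<A>"
proof (rule ccontr)
  assume "\<nexists>x. x \<notin> \<Union>\<A>"
  moreover have "\<A> \<subseteq> meagre_ideal" using assms(1) unfolding meagre_ideal_def by blast
  ultimately have "covering meagre_ideal \<A>" unfolding covering_def by blast
  from cov_least(2)[OF this] show False using assms(2) not_ordLess_ordLeq by blast
qed

subsection \<open>A universe of \<open>\<lambda>\<close> many ultrafilters\<close>

text \<open>
  There may be \<open>2\<^sup>\<lambda>\<close> ultrafilters on a bounded subset of \<open>\<lambda>\<close>, too many for them to be the successors
  in a tree of sequences from \<open>\<^sup><\<^sup>\<lambda>\<lambda>\<close>. Only \<open>\<lambda>\<close> many of them are used.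
\<close>

definition universe :: "('a::wellorder \<Rightarrow> 'a set set) \<Rightarrow> bool" where
  "universe u \<longleftrightarrow>
     (\<forall>\<gamma>. ultrafilter_on UNIV (u \<gamma>)) \<and>
     (\<forall>x. {A. x \<in> A} \<in> range u) \<and>
     (\<forall>(\<xi> :: 'a) v. (\<forall>F\<in>fin_below \<xi>. v F \<in> range u) \<longrightarrow> (\<exists>e\<in>range u. is_limit_of \<xi> v e))"

lemma universeD:
  fixes u :: "'a::wellorder \<Rightarrow> 'a set set"
  assumes "universe u"
  shows "e \<in> range u \<Longrightarrow> ultrafilter_on UNIV e" "{A. x \<in> A} \<in> range u"
    "(\<And>F. F \<in> fin_below (\<xi> :: 'a) \<Longrightarrow> v F \<in> range u) \<Longrightarrow> \<exists>e\<in>range u. is_limit_of \<xi> v e"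
proof -
  note u = assms[unfolded universe_def]
  show "e \<in> range u \<Longrightarrow> ultrafilter_on UNIV e" using conjunct1[OF u] by auto
  show "{A. x \<in> A} \<in> range u" using conjunct1[OF conjunct2[OF u]] by (rule spec)
  show "(\<And>F. F \<in> fin_below \<xi> \<Longrightarrow> v F \<in> range u) \<Longrightarrow> \<exists>e\<in>range u. is_limit_of \<xi> v e"
    by (rule conjunct2[OF conjunct2[OF u], rule_format])
qed

lemma is_limit_of_cong:
  assumes "\<And>F. F \<in> fin_below \<xi> \<Longrightarrow> v F = w F"
  shows "is_limit_of \<xi> v e \<longleftrightarrow> is_limit_of \<xi> w e"
  unfolding is_limit_of_def using assms by (simp cong: ball_cong)

context
  assumes lam_card: "card_order (lam :: 'a::wellorder rel)"
    and lam_reg: "regularCard (lam :: 'a rel)"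
    and lam_unc: "natLeq <o (lam :: 'a rel)"
    and lam_exp: "|short_seqs :: ('a \<rightharpoonup> 'a) set| =o (lam :: 'a rel)"
begin

text \<open>
  The last component of a code makes every net appear at arbitrarily late stages, and names the
  principal ultrafilters when the first component is empty.
\<close>

lemma codes_exist:
  "\<exists>h :: 'a \<Rightarrow> ('a \<rightharpoonup> 'a) \<times> 'a \<times> 'a. range h = short_seqs \<times> UNIV"
proof -
  note inf = infinite_lam[OF lam_card lam_reg lam_unc]
  have "Card_order |UNIV :: 'a set|" by (rule card_of_Card_order)
  \<comment> \<open>Here the hypothesis \<lambda>^(<\<lambda>) = \<lambda> enters.\<close>
  moreover have "|short_seqs :: ('a \<rightharpoonup> 'a) set| \<le>o |UNIV :: 'a set|"
    using lam_exp lam_ordIso[OF lam_card lam_reg lam_unc] ordIso_iff_ordLeq ordIso_transitive by blast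
  moreover have "|UNIV :: ('a \<times> 'a) set| \<le>o |UNIV :: 'a set|"
    using card_of_Times_same_infinite[OF inf] ordIso_imp_ordLeq unfolding UNIV_Times_UNIV by blast
  ultimately have "|(short_seqs :: ('a \<rightharpoonup> 'a) set) \<times> (UNIV :: ('a \<times> 'a) set)| \<le>o |UNIV :: 'a set|"
    by (intro card_of_Times_ordLeq_infinite_Field) (simp_all only: Field_card_of inf not_False_eq_True)
  moreover have "(Map.empty, undefined) \<in> (short_seqs :: ('a \<rightharpoonup> 'a) set) \<times> (UNIV :: ('a \<times> 'a) set)"
    unfolding short_seqs_def using not_less_Least[of _ "\<lambda>_ :: 'a. True"]
    by (auto intro!: exI[of _ "LEAST x. True"])
  ultimately show ?thesis
    using card_of_ordLeq2[of "(short_seqs :: ('a \<rightharpoonup> 'a) set) \<times> (UNIV :: ('a \<times> 'a) set)" "UNIV :: 'a set"]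
    by blast
qed

text \<open>Recursion on \<open>\<gamma>\<close>: \<open>u \<gamma>\<close> is a limit of the net of
  earlier ultrafilters that the code \<open>h \<gamma>\<close> describes. A net has fewer than
  \<lambda> members, so their indices are bounded, and the net is coded again at some stage beyond
  the bound.\<close>

lemma universe_exists: "\<exists>u :: 'a \<Rightarrow> 'a set set. universe u"
proof -
  note inf = infinite_lam[OF lam_card lam_reg lam_unc]
  obtain h :: "'a \<Rightarrow> ('a \<rightharpoonup> 'a) \<times> 'a \<times> 'a" where h: "range h = short_seqs \<times> UNIV"
    using codes_exist by blast
  have "|{F :: 'a set. finite F \<and> F \<subseteq> UNIV}| \<le>o |UNIV :: 'a set|"
    by (rule card_of_finite_subsets[OF inf])
  \<comment> \<open>\<open>\<phi>\<close> turns finite sets into ordinals, so that the indices of a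
    net can be listed by a member of \<open>short_seqs\<close>.\<close>
  then obtain \<phi> :: "'a set \<Rightarrow> 'a" where "inj_on \<phi> {F :: 'a set. finite F \<and> F \<subseteq> UNIV}"
    unfolding card_of_ordLeq[symmetric] by blast
  then have \<phi>: "inj_on \<phi> (fin_below \<xi>)" for \<xi>
    by (rule inj_on_subset) (auto simp: fin_below_def)
  define P where "P f \<gamma> e \<longleftrightarrow> ultrafilter_on UNIV e \<and> (case h \<gamma> of (s, \<xi>, \<beta>) \<Rightarrow>
      (s = Map.empty \<longrightarrow> e = {A. \<beta> \<in> A}) \<and>
      (s \<noteq> Map.empty \<and> (\<forall>F\<in>fin_below \<xi>. \<exists>j<\<gamma>. s (\<phi> F) = Some j) \<longrightarrow>
         is_limit_of \<xi> (\<lambda>F. f (the (s (\<phi> F)))) e))" for f :: "'a \<Rightarrow> 'a set set" and \<gamma> e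
  have "\<exists>u. \<forall>\<gamma>. P u \<gamma> (u \<gamma>)"
  proof (rule dependent_wellorder_choice)
    fix e and f g :: "'a \<Rightarrow> 'a set set" and \<gamma> assume fg: "\<And>y. y < \<gamma> \<Longrightarrow> f y = g y"
    obtain s \<xi> \<beta> where hg: "h \<gamma> = (s, \<xi>, \<beta>)" by (cases "h \<gamma>")
    have "is_limit_of \<xi> (\<lambda>F. f (the (s (\<phi> F)))) e \<longleftrightarrow> is_limit_of \<xi> (\<lambda>F. g (the (s (\<phi> F)))) e"
      if "\<forall>F\<in>fin_below \<xi>. \<exists>j<\<gamma>. s (\<phi> F) = Some j"
      by (rule is_limit_of_cong) (use that fg in fastforce)
    then show "P f \<gamma> e = P g \<gamma> e" unfolding P_def hg by auto
  next
    fix \<gamma> and f :: "'a \<Rightarrow> 'a set set" assume IH: "\<And>y. y < \<gamma> \<Longrightarrow> P f y (f y)"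
    obtain s \<xi> \<beta> where hg: "h \<gamma> = (s, \<xi>, \<beta>)" by (cases "h \<gamma>")
    show "\<exists>e. P f \<gamma> e"
    proof (cases "s \<noteq> Map.empty \<and> (\<forall>F\<in>fin_below \<xi>. \<exists>j<\<gamma>. s (\<phi> F) = Some j)")
      case True
      have "ultrafilter_on UNIV (f (the (s (\<phi> F))))" if "F \<in> fin_below \<xi>" for F
        using True that IH unfolding P_def by fastforce
      from ultrafilter_limit_exists[of \<xi> "\<lambda>F. f (the (s (\<phi> F)))", OF this]
      show ?thesis using True unfolding P_def hg by auto
    next
      case False
      \<comment> \<open>If the code describes no net of earlier ultrafilters, the principal one at
        \<open>\<beta>\<close> is taken: as prescribed when \<open>s\<close> is empty, as a filler
        otherwise.\<close>
      then show ?thesis unfolding P_def hg using ultrafilter_principal[of \<beta>]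
        by (intro exI[of _ "{A. \<beta> \<in> A}"]) auto
    qed
  qed
  then obtain u where u: "\<And>\<gamma>. P u \<gamma> (u \<gamma>)" by blast
  have "universe u" unfolding universe_def
  proof (intro conjI allI impI)
    show "ultrafilter_on UNIV (u \<gamma>)" for \<gamma> using u unfolding P_def by blast
  next
    fix x
    have "(Map.empty, x, x) \<in> range h" unfolding h short_seqs_def
      using not_less_Least[of _ "\<lambda>_ :: 'a. True"] by (auto intro!: exI[of _ "LEAST x. True"])
    then obtain \<gamma> where "h \<gamma> = (Map.empty, x, x)" by (metis rangeE)
    then have "u \<gamma> = {A. x \<in> A}" using u[of \<gamma>] unfolding P_def by simp
    then show "{A. x \<in> A} \<in> range u" by (metis rangeI)
  next
    fix \<xi> and v :: "'a set \<Rightarrow> 'a set set" assume "\<forall>F\<in>fin_below \<xi>. v F \<in> range u"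
    then have "\<forall>F\<in>fin_below \<xi>. \<exists>i. u i = v F" by force
    then obtain j where j: "\<And>F. F \<in> fin_below \<xi> \<Longrightarrow> u (j F) = v F" by (auto dest!: bchoice)
    obtain \<gamma>0 where \<gamma>0: "\<And>F. F \<in> fin_below \<xi> \<Longrightarrow> j F < \<gamma>0"
      using fin_below_bounded[OF lam_card lam_reg lam_unc] by blast
    obtain \<alpha> where \<alpha>: "\<And>F. F \<in> fin_below \<xi> \<Longrightarrow> \<phi> F < \<alpha>"
      using fin_below_bounded[OF lam_card lam_reg lam_unc] by blast
    \<comment> \<open>A short sequence must be defined on a whole initial segment; its values
      outside the image of \<open>\<phi>\<close> are fillers.\<close>
    define s where "s \<rho> = (if \<rho> < \<alpha> then Some (j (inv_into (fin_below \<xi>) \<phi> \<rho>)) else None)" for \<rho>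
    have s: "s (\<phi> F) = Some (j F)" if "F \<in> fin_below \<xi>" for F
      unfolding s_def using \<alpha>[OF that] \<phi> that by (simp add: inv_into_f_f)
    \<comment> \<open>\<open>s\<close> is defined at \<open>\<phi> {}\<close>, hence differs from
      the empty map that marks principal ultrafilters.\<close>
    have "{} \<in> fin_below \<xi>" unfolding fin_below_def by simp
    from s[OF this] have ne: "s \<noteq> Map.empty" by auto
    have "s \<in> short_seqs" unfolding short_seqs_def s_def by (auto simp: dom_def split: if_splits)
    then have "(s, \<xi>, \<beta>) \<in> range h" for \<beta> unfolding h by simp
    then have "\<forall>\<beta>. \<exists>\<gamma>. h \<gamma> = (s, \<xi>, \<beta>)" by (simp add: image_iff eq_commute)
    then obtain g where g: "\<And>\<beta>. h (g \<beta>) = (s, \<xi>, \<beta>)" by metis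
    \<comment> \<open>The last component of the code yields \<lambda> many stages for the same net,
      too many to lie below \<open>\<gamma>0\<close>.\<close>
    then have "inj g" by (intro injI) (metis prod.inject)
    then have "\<not> g ` UNIV \<subseteq> {..<\<gamma>0}"
      using ordLess_lessThan[OF lam_card lam_reg lam_unc, of \<gamma>0] unfolding card_of_ordLess[symmetric] by blast
    then obtain \<beta> where \<beta>: "\<gamma>0 \<le> g \<beta>" by (metis image_subset_iff lessThan_iff not_less)
    have "\<forall>F\<in>fin_below \<xi>. \<exists>i<g \<beta>. s (\<phi> F) = Some i"
      using s less_le_trans[OF \<gamma>0 \<beta>] by auto
    then have "is_limit_of \<xi> (\<lambda>F. u (the (s (\<phi> F)))) (u (g \<beta>))"
      using u[of "g \<beta>"] ne unfolding P_def g by auto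
    then have "is_limit_of \<xi> v (u (g \<beta>))"
      using is_limit_of_cong[of \<xi> "\<lambda>F. u (the (s (\<phi> F)))" v] s j by simp
    then show "\<exists>e\<in>range u. is_limit_of \<xi> v e" by blast
  qed
  then show ?thesis by blast
qed

end

subsection \<open>Conditions\<close>

text \<open>For a condition and a point of its club, this is the ultrafilter on the whole of
  \<lambda> generated by \<open>d \<delta>\<close>. It allows comparing conditions with different
  intervals.\<close>

definition ext :: "'a::wellorder condition \<Rightarrow> 'a \<Rightarrow> 'a set set" where
  "ext p \<delta> = {A. A \<inter> fst (snd p) \<delta> \<in> snd (snd p) \<delta>}"

text \<open>For \<open>p \<in> Q0\<close> and an ultrafilter \<open>e\<close>,
  \<open>tail_sets p \<epsilon> \<subseteq> e\<close> says that \<open>e\<close> lies in the closure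
  of the ultrafilters of \<open>p\<close> from \<open>\<epsilon>\<close> on.\<close>

definition tail_sets :: "'a::wellorder condition \<Rightarrow> 'a \<Rightarrow> 'a set set" where
  "tail_sets p \<epsilon> = {A. \<forall>\<delta>\<in>fst p. \<epsilon> \<le> \<delta> \<longrightarrow> A \<in> ext p \<delta>}"

lemma fil_eq: "fil p = (\<Union>\<epsilon>. tail_sets p \<epsilon>)"
  by (cases p) (auto simp: fil_def tail_sets_def ext_def)

lemma tail_sets_mono: "\<epsilon> \<le> \<epsilon>' \<Longrightarrow> tail_sets p \<epsilon> \<subseteq> tail_sets p \<epsilon>'"
  unfolding tail_sets_def by force

text \<open>\<open>tail_sets p \<delta>\<close> increases with \<open>\<delta>\<close>, so a set in
  \<open>fil p\<close> belongs to it for all large \<open>\<delta>\<close>, and thereby to the late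
  ultrafilters of \<open>q\<close>.\<close>

lemma le0I:
  assumes "\<And>\<delta>. \<delta> \<in> fst q \<Longrightarrow> \<epsilon> \<le> \<delta> \<Longrightarrow> tail_sets p \<delta> \<subseteq> ext q \<delta>"
  shows "p \<le>\<^sup>0 q"
  unfolding le0_def
proof
  fix A assume "A \<in> fil p"
  then obtain \<epsilon>' where A: "A \<in> tail_sets p \<epsilon>'" unfolding fil_eq by blast
  have "A \<in> ext q \<delta>" if "\<delta> \<in> fst q" "max \<epsilon> \<epsilon>' \<le> \<delta>" for \<delta>
    using assms[OF that(1)] that(2) tail_sets_mono[of \<epsilon>' \<delta> p] A by auto
  then have "A \<in> tail_sets q (max \<epsilon> \<epsilon>')" unfolding tail_sets_def by blast
  then show "A \<in> fil q" unfolding fil_eq by blast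
qed

lemma Q0_ext:
  assumes "p \<in> Q0" "\<delta> \<in> fst p"
  shows "{} \<notin> ext p \<delta>" "{\<delta>..} \<in> ext p \<delta>" "A \<in> ext p \<delta> \<Longrightarrow> A \<subseteq> B \<Longrightarrow> B \<in> ext p \<delta>"
    "A \<in> ext p \<delta> \<Longrightarrow> B \<in> ext p \<delta> \<Longrightarrow> A \<inter> B \<in> ext p \<delta>"
proof -
  obtain C Z d where p: "p = (C, Z, d)" by (cases p)
  have Z: "Z \<delta> = {\<delta>..<(LEAST \<beta>. \<beta> \<in> C \<and> \<delta> < \<beta>)}" and uf: "ultrafilter_on (Z \<delta>) (d \<delta>)"
    using assms unfolding p Q0_def by auto
  have e: "ext p \<delta> = {A. A \<inter> Z \<delta> \<in> d \<delta>}" unfolding ext_def p by simp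
  show "{} \<notin> ext p \<delta>" using uf unfolding e ultrafilter_on_def by simp
  have "{\<delta>..} \<inter> Z \<delta> = Z \<delta>" unfolding Z by auto
  then show "{\<delta>..} \<in> ext p \<delta>" using uf unfolding e ultrafilter_on_def by simp
  show "B \<in> ext p \<delta>" if "A \<in> ext p \<delta>" "A \<subseteq> B"
  proof -
    have "A \<inter> Z \<delta> \<subseteq> B \<inter> Z \<delta>" "B \<inter> Z \<delta> \<subseteq> Z \<delta>" using that(2) by auto
    then show ?thesis using uf that(1) unfolding e ultrafilter_on_def by blast
  qed
  have "A \<inter> B \<inter> Z \<delta> = (A \<inter> Z \<delta>) \<inter> (B \<inter> Z \<delta>)" by auto
  then show "A \<inter> B \<in> ext p \<delta>" if "A \<in> ext p \<delta>" "B \<in> ext p \<delta>"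
    using uf that unfolding e ultrafilter_on_def by simp
qed

lemma Q0_club: "p \<in> Q0 \<Longrightarrow> club (fst p)"
  unfolding Q0_def by auto

lemma Q0_unbounded: "p \<in> Q0 \<Longrightarrow> \<exists>\<delta>\<in>fst p. \<epsilon> \<le> \<delta>"
  using Q0_club unfolding club_def by (meson less_imp_le)

lemma fil_up:
  assumes "p \<in> Q0" "A \<in> fil p" "A \<subseteq> B"
  shows "B \<in> fil p"
  using assms Q0_ext(3)[OF assms(1)] unfolding fil_eq tail_sets_def by blast

lemma fil_Int:
  assumes "p \<in> Q0" "A \<in> fil p" "B \<in> fil p"
  shows "A \<inter> B \<in> fil p"
proof -
  obtain \<epsilon> \<epsilon>' where "A \<in> tail_sets p \<epsilon>" "B \<in> tail_sets p \<epsilon>'" using assms unfolding fil_eq by blast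
  then have "A \<in> tail_sets p (max \<epsilon> \<epsilon>')" "B \<in> tail_sets p (max \<epsilon> \<epsilon>')"
    using tail_sets_mono[of \<epsilon> "max \<epsilon> \<epsilon>'" p] tail_sets_mono[of \<epsilon>' "max \<epsilon> \<epsilon>'" p] by auto
  then have "A \<inter> B \<in> tail_sets p (max \<epsilon> \<epsilon>')"
    using Q0_ext(4)[OF assms(1)] unfolding tail_sets_def by blast
  then show ?thesis unfolding fil_eq by blast
qed

lemma fil_unbounded:
  assumes "p \<in> Q0" "A \<in> fil p"
  shows "\<exists>\<beta>\<in>A. \<alpha> \<le> \<beta>"
proof -
  obtain \<epsilon> where A: "A \<in> tail_sets p \<epsilon>" using assms unfolding fil_eq by blast
  obtain \<delta> where \<delta>: "\<delta> \<in> fst p" "max \<epsilon> \<alpha> \<le> \<delta>" using Q0_unbounded[OF assms(1)] by blast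
  have "A \<inter> {\<delta>..} \<in> ext p \<delta>"
    using A \<delta> Q0_ext(2,4)[OF assms(1) \<delta>(1)] unfolding tail_sets_def by auto
  then have "A \<inter> {\<delta>..} \<noteq> {}" using Q0_ext(1)[OF assms(1) \<delta>(1)] by auto
  then show ?thesis using \<delta>(2) by fastforce
qed

text \<open>The given \<open>e \<delta>\<close> are ultrafilters on the whole of \<lambda>. If
  \<open>e \<delta>\<close> contains the interval up to the next point of \<open>C\<close>, its
  members inside that interval determine it, and \<open>ext\<close> recovers it.\<close>

definition mk_cond :: "'a::wellorder set \<Rightarrow> ('a \<Rightarrow> 'a set set) \<Rightarrow> 'a condition" where
  "mk_cond C e =
     (C, \<lambda>\<delta>\<in>C. {\<delta>..<(LEAST \<beta>. \<beta> \<in> C \<and> \<delta> < \<beta>)},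
      \<lambda>\<delta>\<in>C. {A \<in> e \<delta>. A \<subseteq> {\<delta>..<(LEAST \<beta>. \<beta> \<in> C \<and> \<delta> < \<beta>)}})"

lemma fst_mk_cond [simp]: "fst (mk_cond C e) = C"
  by (simp add: mk_cond_def)

lemma ultrafilter_trace:
  assumes "ultrafilter_on UNIV e" "Z \<in> e"
  shows "ultrafilter_on Z {A \<in> e. A \<subseteq> Z}" "{A. A \<inter> Z \<in> e \<and> A \<inter> Z \<subseteq> Z} = e"
proof -
  note e = ultrafilter_onD[OF assms(1)]
  show "{A. A \<inter> Z \<in> e \<and> A \<inter> Z \<subseteq> Z} = e"
    using e(3,4) assms(2) by blast
  have "A \<in> e \<or> Z - A \<in> e" for A
    using e(5)[of A] e(4)[OF assms(2), of "- A"] by (auto simp: Diff_eq)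
  then show "ultrafilter_on Z {A \<in> e. A \<subseteq> Z}"
    unfolding ultrafilter_on_def using e(1,3,4) assms(2) by auto
qed

lemma mk_cond_Q0:
  assumes "club C" "\<And>\<delta>. \<delta> \<in> C \<Longrightarrow> is_limit \<delta>" "\<And>\<delta>. \<delta> \<in> C \<Longrightarrow> ultrafilter_on UNIV (e \<delta>)"
    and "\<And>\<delta>. \<delta> \<in> C \<Longrightarrow> {\<delta>..<(LEAST \<beta>. \<beta> \<in> C \<and> \<delta> < \<beta>)} \<in> e \<delta>"
  shows "mk_cond C e \<in> Q0" "\<delta> \<in> C \<Longrightarrow> ext (mk_cond C e) \<delta> = e \<delta>"
proof -
  note tr = ultrafilter_trace[OF assms(3,4)]
  show "mk_cond C e \<in> Q0" using assms(1,2) tr(1) unfolding mk_cond_def Q0_def by simp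
  show "ext (mk_cond C e) \<delta> = e \<delta>" if "\<delta> \<in> C"
    using that tr(2)[OF that that] unfolding mk_cond_def ext_def by simp
qed

subsection \<open>Extending a compatible set of conditions\<close>

text \<open>The bound \<open>\<zeta>\<close> lets \<open>e\<close> fit into an interval of a new
  condition, and \<open>range u\<close> makes it codable by an ordinal. \<open>B\<close> is a set
  that the new condition is to decide positively. Only finite \<open>F\<close> are tested, so the
  property survives limit stages.\<close>

definition compatible :: "('a::wellorder \<Rightarrow> 'a set set) \<Rightarrow> 'a set \<Rightarrow> 'a condition set \<Rightarrow> bool" where
  "compatible u B G \<longleftrightarrow>
     (\<forall>F \<epsilon>. finite F \<and> F \<subseteq> G \<longrightarrow>
        (\<exists>e\<in>range u. \<exists>\<zeta>. B \<in> e \<and> {\<epsilon>..<\<zeta>} \<in> e \<and> (\<forall>p\<in>F. tail_sets p \<epsilon> \<subseteq> e)))"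

lemma compatibleD:
  assumes "compatible u B G" "finite F" "F \<subseteq> G"
  shows "\<exists>e \<zeta>. e \<in> range u \<and> B \<in> e \<and> {\<epsilon>..<\<zeta>} \<in> e \<and> (\<forall>p\<in>F. tail_sets p \<epsilon> \<subseteq> e)"
  using assms(1)[unfolded compatible_def, rule_format, of F \<epsilon>] assms(2,3) by blast

text \<open>If \<open>(F, \<epsilon>)\<close> refutes \<open>A\<close> and
  \<open>(F', \<epsilon>')\<close> refutes \<open>- A\<close>, an ultrafilter for
  \<open>F \<union> F'\<close> beyond \<open>max \<epsilon> \<epsilon>'\<close> serves both pairs,
  yet it contains \<open>A\<close> or \<open>- A\<close>.\<close>

lemma compatible_split:
  assumes u: "universe u" and G: "compatible u UNIV G"
  shows "compatible u A G \<or> compatible u (- A) G"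
proof (rule ccontr)
  assume "\<not> ?thesis"
  then obtain F \<epsilon> F' \<epsilon>' where F: "finite F" "F \<subseteq> G" "finite F'" "F' \<subseteq> G"
    and n: "\<And>e \<zeta>. e \<in> range u \<Longrightarrow> {\<epsilon>..<\<zeta>} \<in> e \<Longrightarrow> (\<And>p. p \<in> F \<Longrightarrow> tail_sets p \<epsilon> \<subseteq> e) \<Longrightarrow> A \<notin> e"
      "\<And>e \<zeta>. e \<in> range u \<Longrightarrow> {\<epsilon>'..<\<zeta>} \<in> e \<Longrightarrow> (\<And>p. p \<in> F' \<Longrightarrow> tail_sets p \<epsilon>' \<subseteq> e) \<Longrightarrow> - A \<notin> e"
    unfolding compatible_def by metis
  have "finite (F \<union> F')" "F \<union> F' \<subseteq> G" using F by auto
  from compatibleD[OF G this, of "max \<epsilon> \<epsilon>'"] obtain e \<zeta>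
    where e: "e \<in> range u" "{max \<epsilon> \<epsilon>'..<\<zeta>} \<in> e"
      "\<forall>p\<in>F \<union> F'. tail_sets p (max \<epsilon> \<epsilon>') \<subseteq> e"
    by (elim exE conjE) (rule that)
  have uf: "ultrafilter_on UNIV e" using e(1) by (rule universeD(1)[OF u])
  have "{\<epsilon>..<\<zeta>} \<in> e" "{\<epsilon>'..<\<zeta>} \<in> e"
    by (rule ultrafilter_onD(3)[OF uf e(2)]; auto)+
  moreover have "tail_sets p \<epsilon> \<subseteq> e" if "p \<in> F" for p
    using e(3) that tail_sets_mono[of \<epsilon> "max \<epsilon> \<epsilon>'" p] by auto
  moreover have "tail_sets p \<epsilon>' \<subseteq> e" if "p \<in> F'" for p
    using e(3) that tail_sets_mono[of \<epsilon>' "max \<epsilon> \<epsilon>'" p] by auto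
  ultimately have "A \<notin> e" "- A \<notin> e" using n e(1) by metis+
  then show False using ultrafilter_onD(5)[OF uf] by blast
qed

lemma compatible_finite_subsets:
  assumes "\<And>F. finite F \<Longrightarrow> F \<subseteq> G \<Longrightarrow> compatible u B F"
  shows "compatible u B G"
  using assms unfolding compatible_def by blast

section \<open>Limits of a compatible set and the extension step\<close>

context
  assumes lam_card: "card_order (lam :: 'a::wellorder rel)"
    and lam_reg: "regularCard (lam :: 'a rel)"
    and lam_unc: "natLeq <o (lam :: 'a rel)"
begin

lemma compatible_empty:
  assumes "universe (u :: 'a \<Rightarrow> 'a set set)"
  shows "compatible u UNIV {}"
  unfolding compatible_def
proof (intro allI impI)
  fix F :: "'a condition set" and \<epsilon> :: 'a assume "finite F \<and> F \<subseteq> {}"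
  moreover obtain \<zeta> where "\<epsilon> < \<zeta>" using greater_exists[OF lam_card lam_reg lam_unc] by blast
  moreover have "{A. \<epsilon> \<in> A} \<in> range u" by (rule universeD(2)[OF assms])
  ultimately show "\<exists>e\<in>range u. \<exists>\<zeta>. UNIV \<in> e \<and> {\<epsilon>..<\<zeta>} \<in> e \<and> (\<forall>p\<in>F. tail_sets p \<epsilon> \<subseteq> e)"
    by (intro bexI[of _ "{A. \<epsilon> \<in> A}"] exI[of _ \<zeta>]) auto
qed

text \<open>
  The ultrafilters chosen for the finite sets of indices below \<open>\<xi>\<close> all live below one \<open>\<zeta> < \<lambda>\<close>, hence so
  does their limit.
\<close>

lemma compatible_limit:
  fixes u :: "'a \<Rightarrow> 'a set set" and \<epsilon> \<xi> :: 'a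
  assumes u: "universe u" and G: "compatible u B G" and F: "finite F" "F \<subseteq> G"
  shows "\<exists>e \<zeta>. e \<in> range u \<and> B \<in> e \<and> {\<epsilon>..<\<zeta>} \<in> e \<and> (\<forall>p\<in>F. tail_sets p \<epsilon> \<subseteq> e) \<and>
           (\<forall>i<\<xi>. k i \<in> G \<longrightarrow> tail_sets (k i) \<epsilon> \<subseteq> e)"
proof -
  \<comment> \<open>The members of the net: for finite \<open>I\<close>, a limit of \<open>F\<close>
    together with those \<open>k i\<close>, \<open>i \<in> I\<close>, that lie in
    \<open>G\<close>.\<close>
  have "\<exists>e \<zeta>. e \<in> range u \<and> B \<in> e \<and> {\<epsilon>..<\<zeta>} \<in> e \<and> (\<forall>p\<in>F \<union> k ` I \<inter> G. tail_sets p \<epsilon> \<subseteq> e)"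
    if "I \<in> fin_below \<xi>" for I
  proof -
    have "finite (F \<union> k ` I \<inter> G)" "F \<union> k ` I \<inter> G \<subseteq> G" using that F unfolding fin_below_def by auto
    from compatibleD[OF G this] show ?thesis .
  qed
  then have "\<forall>I\<in>fin_below \<xi>. \<exists>v. fst v \<in> range u \<and> B \<in> fst v \<and> {\<epsilon>..<snd v} \<in> fst v \<and>
      (\<forall>p\<in>F \<union> k ` I \<inter> G. tail_sets p \<epsilon> \<subseteq> fst v)" by simp
  from bchoice[OF this] obtain v where v: "\<forall>I\<in>fin_below \<xi>. fst (v I) \<in> range u \<and> B \<in> fst (v I) \<and>
      {\<epsilon>..<snd (v I)} \<in> fst (v I) \<and> (\<forall>p\<in>F \<union> k ` I \<inter> G. tail_sets p \<epsilon> \<subseteq> fst (v I))" ..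
  note v = v[THEN bspec, THEN conjunct1] v[THEN bspec, THEN conjunct2, THEN conjunct1]
    v[THEN bspec, THEN conjunct2, THEN conjunct2, THEN conjunct1]
    v[THEN bspec, THEN conjunct2, THEN conjunct2, THEN conjunct2, THEN bspec]
  obtain \<zeta> where \<zeta>: "\<And>I. I \<in> fin_below \<xi> \<Longrightarrow> snd (v I) < \<zeta>"
    using fin_below_bounded[OF lam_card lam_reg lam_unc, of \<xi> "\<lambda>I. snd (v I)"] by blast
  from universeD(3)[OF u v(1)] obtain e where e: "e \<in> range u" "is_limit_of \<xi> (\<lambda>I. fst (v I)) e" ..
  have emp: "{} \<in> fin_below \<xi>" unfolding fin_below_def by simp
  note lim = is_limit_ofD[OF e(2)]
  show ?thesis
  proof (intro exI[of _ e] exI[of _ \<zeta>] conjI ballI allI impI)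
    show "B \<in> e" using lim[OF emp] v(2) by blast
    have "{\<epsilon>..<\<zeta>} \<in> fst (v I)" if "I \<in> fin_below \<xi>" for I
    proof -
      have "ultrafilter_on UNIV (fst (v I))" using v(1)[OF that] by (rule universeD(1)[OF u])
      moreover have "{\<epsilon>..<snd (v I)} \<subseteq> {\<epsilon>..<\<zeta>}" using \<zeta>[OF that] by auto
      ultimately show ?thesis using ultrafilter_onD(3) v(3)[OF that] by blast
    qed
    then show "{\<epsilon>..<\<zeta>} \<in> e" using lim[OF emp] by blast
    show "tail_sets p \<epsilon> \<subseteq> e" if "p \<in> F" for p
      using lim[OF emp] v(4) that by blast
    \<comment> \<open>From \<open>{i}\<close> on, every member of the net contains
      \<open>tail_sets (k i) \<epsilon>\<close>; hence so does the limit.\<close>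
    show "tail_sets (k i) \<epsilon> \<subseteq> e" if "i < \<xi>" "k i \<in> G" for i
    proof
      fix A assume "A \<in> tail_sets (k i) \<epsilon>"
      moreover have "{i} \<in> fin_below \<xi>" using that(1) unfolding fin_below_def by simp
      ultimately show "A \<in> e" using lim[of "{i}" A] v(4)[of _ "k i"] that(2) by blast
    qed
  qed (rule e(1))
qed

text \<open>
  A point of \<open>\<^sup>\<lambda>\<lambda>\<close> codes a sequence of ultrafilters, those values that do not fit being replaced by a
  default. For finite \<open>F \<subseteq> G\<close> and \<open>\<epsilon> < \<lambda>\<close>, the points whose condition has no ultrafilter beyond \<open>\<epsilon>\<close>
  that is a limit of each member of \<open>F\<close> form a nowhere dense set.
\<close>

lemma compatible_extend:
  fixes u :: "'a \<Rightarrow> 'a set set" and f :: "'a \<Rightarrow> 'a"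
  assumes u: "universe u" and G: "compatible u UNIV G"
    and small: "|G| <o |UNIV :: 'a set set|"
    and cov: "|UNIV :: 'a set set| \<le>o cov (meagre_ideal :: ('a \<Rightarrow> 'a) set set)"
  shows "\<exists>r\<in>Q0. compatible u UNIV (insert r G) \<and> (A \<in> fil r \<or> - A \<in> fil r) \<and> (\<forall>i :: 'a. k i \<in> G \<longrightarrow> k i \<le>\<^sup>0 r) \<and>
           - (\<Union>\<delta>\<in>fst r. {\<delta>..<oadd \<delta> (f \<delta>)}) \<in> fil r"
proof -
  note lam = lam_card lam_reg lam_unc
  obtain B where B: "B = A \<or> B = - A" "compatible u B G"
    using compatible_split[OF u G] by blast
  \<comment> \<open>An ultrafilter admissible at \<open>\<xi>\<close> lives past the gap prescribed
    by \<open>f\<close> and is a limit, beyond \<open>\<xi>\<close>, of those \<open>k i\<close> in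
    \<open>G\<close> with \<open>i < \<xi>\<close>. Asking only for these at \<open>\<xi>\<close> is
    the diagonal choice.\<close>
  define fits where "fits \<xi> e \<zeta> \<longleftrightarrow> e \<in> range u \<and> B \<in> e \<and> {oadd \<xi> (f \<xi>)..<\<zeta>} \<in> e \<and>
      (\<forall>i<\<xi>. k i \<in> G \<longrightarrow> tail_sets (k i) \<xi> \<subseteq> e)" for \<xi> e \<zeta>
  have fits_ex: "\<exists>e \<zeta>. fits \<xi> e \<zeta> \<and> (\<forall>p\<in>F. tail_sets p \<epsilon> \<subseteq> e)"
    if F: "finite F" "F \<subseteq> G" for F \<epsilon> \<xi>
  proof -
    let ?\<epsilon> = "max \<epsilon> (oadd \<xi> (f \<xi>))"
    from compatible_limit[OF u B(2) F, of ?\<epsilon> \<xi> k] obtain e \<zeta>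
      where e: "e \<in> range u" "B \<in> e" "{?\<epsilon>..<\<zeta>} \<in> e" "\<forall>p\<in>F. tail_sets p ?\<epsilon> \<subseteq> e"
        "\<forall>i<\<xi>. k i \<in> G \<longrightarrow> tail_sets (k i) ?\<epsilon> \<subseteq> e"
      by (elim exE conjE) (rule that)
    have "ultrafilter_on UNIV e" using e(1) by (rule universeD(1)[OF u])
    from ultrafilter_onD(3)[OF this e(3)] have "{oadd \<xi> (f \<xi>)..<\<zeta>} \<in> e" by auto
    moreover have "\<epsilon> \<le> ?\<epsilon>" "\<xi> \<le> ?\<epsilon>" using oadd_ge[OF lam, of \<xi> "f \<xi>"] by (auto simp: le_max_iff_disj)
    then have "tail_sets p \<epsilon> \<subseteq> tail_sets p ?\<epsilon>" "tail_sets p \<xi> \<subseteq> tail_sets p ?\<epsilon>" for p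
      by (simp_all only: tail_sets_mono)
    ultimately show ?thesis using e unfolding fits_def
      by (intro exI[of _ e] exI[of _ \<zeta>]) blast
  qed
  define dflt where "dflt \<xi> = (SOME e. \<exists>\<zeta>. fits \<xi> e \<zeta>)" for \<xi>
  have dflt: "\<exists>\<zeta>. fits \<xi> (dflt \<xi>) \<zeta>" for \<xi>
    unfolding dflt_def by (rule someI_ex) (use fits_ex[of "{}"] in auto)
  define g where "g x \<xi> = (if \<exists>\<zeta>. fits \<xi> (u (x \<xi>)) \<zeta> then u (x \<xi>) else dflt \<xi>)" for x \<xi>
  define z where "z x \<xi> = (SOME \<zeta>. fits \<xi> (g x \<xi>) \<zeta>)" for x \<xi>
  have fits: "fits \<xi> (g x \<xi>) (z x \<xi>)" for x \<xi>
    unfolding z_def by (rule someI_ex) (use dflt in \<open>auto simp: g_def\<close>)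
  define C where "C x = {\<delta>. is_limit \<delta> \<and> (\<forall>\<xi><\<delta>. z x \<xi> \<le> \<delta>)}" for x
  have clubC: "club (C x)" for x unfolding C_def by (rule club_closure_points[OF lam])
  \<comment> \<open>\<open>g x \<xi>\<close> and \<open>z x \<xi>\<close> depend on
    \<open>x \<xi>\<close> alone, so \<open>\<delta> \<in> C x\<close> depends only on
    \<open>x\<close> below \<open>\<delta>\<close>, and the value at \<open>\<delta>\<close> may
    still be changed.\<close>
  have g_cong: "g x \<xi> = g y \<xi>" "z x \<xi> = z y \<xi>" if "x \<xi> = y \<xi>" for x y \<xi>
    unfolding z_def g_def that by (rule refl)+

  define bad where "bad F \<epsilon> = {x. \<forall>\<delta>\<in>C x. \<epsilon> \<le> \<delta> \<longrightarrow> \<not> (\<forall>p\<in>F. tail_sets p \<epsilon> \<subseteq> g x \<delta>)}" for F \<epsilon>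
  have nwd: "nowhere_dense_in seq_topology (bad F \<epsilon>)" if F: "finite F" "F \<subseteq> G" for F \<epsilon>
  proof (rule nowhere_dense_criterion)
    fix x and \<alpha> :: 'a
    \<comment> \<open>At a point \<open>\<delta>\<close> of \<open>C x\<close> beyond
      \<open>\<alpha>\<close> and \<open>\<epsilon>\<close>, the value of \<open>x\<close> is
      replaced by a code \<open>j\<close> of a limit of \<open>F\<close>.\<close>
    obtain \<delta> where \<delta>: "\<delta> \<in> C x" "max \<alpha> \<epsilon> < \<delta>" using clubC[of x] unfolding club_def by blast
    obtain e \<zeta> where e: "fits \<delta> e \<zeta>" "\<forall>p\<in>F. tail_sets p \<epsilon> \<subseteq> e" using fits_ex[OF F] by blast
    then obtain j where j: "e = u j" unfolding fits_def by blast
    obtain \<beta> where \<beta>: "\<delta> < \<beta>" using greater_exists[OF lam] by blast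
    have "w \<notin> bad F \<epsilon>" if w: "\<forall>\<xi><\<beta>. w \<xi> = (x(\<delta> := j)) \<xi>" for w
    proof -
      have "z w \<xi> = z x \<xi>" if "\<xi> < \<delta>" for \<xi>
        by (rule g_cong(2)) (use w \<beta> that in auto)
      then have "\<delta> \<in> C w" using \<delta>(1) unfolding C_def by auto
      moreover have "g w \<delta> = e" using w \<beta> e(1) unfolding g_def j by auto
      ultimately show ?thesis using e(2) \<delta>(2) unfolding bad_def by (auto intro!: bexI[of _ \<delta>])
    qed
    then show "\<exists>y \<beta>. \<alpha> \<le> \<beta> \<and> (\<forall>\<xi><\<alpha>. y \<xi> = x \<xi>) \<and> (\<forall>w. (\<forall>\<xi><\<beta>. w \<xi> = y \<xi>) \<longrightarrow> w \<notin> bad F \<epsilon>)"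
      using \<delta>(2) \<beta> by (intro exI[of _ "x(\<delta> := j)"] exI[of _ \<beta>]) auto
  qed
  let ?\<F> = "{F. finite F \<and> F \<subseteq> G}"
  have inf: "infinite (UNIV :: 'a set set)"
    using infinite_lam[OF lam] by (simp add: Finite_Set.finite_set)
  have lt: "|UNIV :: 'a set| <o |UNIV :: 'a set set|"
    using card_of_Pow[of "UNIV :: 'a set"] by simp
  \<comment> \<open>There are fewer than 2^\<lambda> pairs of a finite \<open>F\<close> and an
    \<open>\<epsilon>\<close>, so the bad sets do not cover the space.\<close>
  have "|?\<F> \<times> (UNIV :: 'a set)| <o |UNIV :: 'a set set|"
    by (rule Times_ordLess[OF inf finite_subsets_ordLess[OF inf small] lt])
  then have "|(\<lambda>(F, \<epsilon>). bad F \<epsilon>) ` (?\<F> \<times> UNIV)| <o cov (meagre_ideal :: ('a \<Rightarrow> 'a) set set)"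
    using card_of_image cov by (meson ordLeq_ordLess_trans ordLess_ordLeq_trans)
  then have "\<exists>x. x \<notin> \<Union> ((\<lambda>(F, \<epsilon>). bad F \<epsilon>) ` (?\<F> \<times> UNIV))"
    by (rule nowhere_dense_family_not_covering[rotated]) (use nwd in auto)
  then obtain x where x: "x \<notin> \<Union> ((\<lambda>(F, \<epsilon>). bad F \<epsilon>) ` (?\<F> \<times> UNIV))" ..

  have uf: "ultrafilter_on UNIV (g x \<xi>)" for \<xi>
    using fits[of \<xi> x] unfolding fits_def by (intro universeD(1)[OF u]) (rule conjunct1)
  have g_int: "{oadd \<xi> (f \<xi>)..<z x \<xi>} \<in> g x \<xi>" for \<xi> using fits[of \<xi> x] unfolding fits_def by blast
  have z_gt: "oadd \<xi> (f \<xi>) < z x \<xi>" for \<xi>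
    using ultrafilter_onD(1)[OF uf[of \<xi>]] g_int[of \<xi>] by (metis atLeastLessThan_empty_iff)
  have next_z: "z x \<delta> \<le> \<delta>'" if "\<delta>' \<in> C x" "\<delta> < \<delta>'" for \<delta> \<delta>' using that unfolding C_def by blast
  define r where "r = mk_cond (C x) (g x)"
  have limC: "is_limit \<delta>" if "\<delta> \<in> C x" for \<delta> using that unfolding C_def by blast
  have "{\<delta>..<(LEAST \<beta>. \<beta> \<in> C x \<and> \<delta> < \<beta>)} \<in> g x \<delta>" if "\<delta> \<in> C x" for \<delta>
  proof -
    have "\<exists>\<beta>. \<beta> \<in> C x \<and> \<delta> < \<beta>" using clubC[of x] unfolding club_def by blast
    \<comment> \<open>The next point of \<open>C x\<close> is at or beyond
      \<open>z x \<delta>\<close>, so the interval carrying \<open>g x \<delta>\<close> ends in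
      time.\<close>
    from LeastI_ex[OF this] have "z x \<delta> \<le> (LEAST \<beta>. \<beta> \<in> C x \<and> \<delta> < \<beta>)" using next_z by blast
    then have "{oadd \<delta> (f \<delta>)..<z x \<delta>} \<subseteq> {\<delta>..<(LEAST \<beta>. \<beta> \<in> C x \<and> \<delta> < \<beta>)}"
      using oadd_ge[OF lam, of \<delta> "f \<delta>"] by auto
    then show ?thesis using ultrafilter_onD(3)[OF uf g_int] by blast
  qed
  note mk = mk_cond_Q0[OF clubC limC uf this, folded r_def]
  have r: "r \<in> Q0" "fst r = C x" "\<And>\<delta>. \<delta> \<in> C x \<Longrightarrow> ext r \<delta> = g x \<delta>"
    using mk unfolding r_def by auto
  have filI: "D \<in> fil r" if "\<And>\<delta>. \<delta> \<in> C x \<Longrightarrow> D \<in> g x \<delta>" for D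
    unfolding fil_eq tail_sets_def using that r(2,3) by auto
  have "B \<in> fil r" by (rule filI) (use fits in \<open>auto simp: fits_def\<close>)
  then have "A \<in> fil r \<or> - A \<in> fil r" using B(1) by blast
  moreover have "k i \<le>\<^sup>0 r" if "k i \<in> G" for i
  proof -
    \<comment> \<open>For every \<open>\<delta>\<close> from such an \<open>\<epsilon>\<close> on,
      \<open>k i\<close> is among the conditions considered at \<open>\<delta>\<close>.\<close>
    obtain \<epsilon> where "i < \<epsilon>" using greater_exists[OF lam] by blast
    then show ?thesis
      using that fits r(2,3) unfolding fits_def by (intro le0I[of _ \<epsilon>]) (metis order_less_le_trans)
  qed
  moreover have "- (\<Union>\<delta>\<in>fst r. {\<delta>..<oadd \<delta> (f \<delta>)}) \<in> fil r"
  proof (rule filI)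
    fix \<delta> assume \<delta>: "\<delta> \<in> C x"
    \<comment> \<open>Gaps of later points start at or beyond \<open>z x \<delta>\<close>, gaps of
      earlier points end before \<open>\<delta>\<close>, and the gap at \<open>\<delta>\<close>
      itself ends where the interval of \<open>g x \<delta>\<close> begins.\<close>
    have "y \<notin> {\<delta>'..<oadd \<delta>' (f \<delta>')}" if y: "oadd \<delta> (f \<delta>) \<le> y" "y < z x \<delta>" and \<delta>': "\<delta>' \<in> C x" for y \<delta>'
    proof (cases \<delta> \<delta>' rule: linorder_cases)
      case less
      then show ?thesis using next_z[OF \<delta>'] y(2) by force
    next
      case greater
      have "oadd \<delta>' (f \<delta>') \<le> y"
        using z_gt[of \<delta>'] next_z[OF \<delta> greater] oadd_ge[OF lam, of \<delta> "f \<delta>"] y(1) by order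
      then show ?thesis by auto
    qed (use y in auto)
    then have "{oadd \<delta> (f \<delta>)..<z x \<delta>} \<subseteq> - (\<Union>\<delta>\<in>fst r. {\<delta>..<oadd \<delta> (f \<delta>)})"
      unfolding r(2) by auto
    then show "- (\<Union>\<delta>\<in>fst r. {\<delta>..<oadd \<delta> (f \<delta>)}) \<in> g x \<delta>"
      using ultrafilter_onD(3)[OF uf g_int] by blast
  qed
  moreover have "compatible u UNIV (insert r G)"
    unfolding compatible_def
  proof (intro allI impI)
    fix F \<epsilon> assume F: "finite F \<and> F \<subseteq> insert r G"
    then have "finite (F - {r})" "F - {r} \<subseteq> G" by auto
    then have "x \<notin> bad (F - {r}) \<epsilon>" using x by auto
    then obtain \<delta> where \<delta>: "\<delta> \<in> C x" "\<epsilon> \<le> \<delta>" "\<forall>p\<in>F - {r}. tail_sets p \<epsilon> \<subseteq> g x \<delta>"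
      unfolding bad_def by blast
    \<comment> \<open>\<open>g x \<delta>\<close> is itself one of the ultrafilters of
      \<open>r\<close> beyond \<open>\<epsilon>\<close>; for the rest of \<open>F\<close> it is a
      limit because \<open>x\<close> avoids the bad set.\<close>
    have "tail_sets r \<epsilon> \<subseteq> g x \<delta>" using \<delta>(1,2) r(2,3) unfolding tail_sets_def by auto
    then have "\<forall>p\<in>F. tail_sets p \<epsilon> \<subseteq> g x \<delta>" using \<delta>(3) by blast
    moreover have "{oadd \<delta> (f \<delta>)..<z x \<delta>} \<subseteq> {\<epsilon>..<z x \<delta>}" using oadd_ge[OF lam, of \<delta> "f \<delta>"] \<delta>(2) by auto
    then have "{\<epsilon>..<z x \<delta>} \<in> g x \<delta>" using ultrafilter_onD(3)[OF uf g_int] by blast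
    moreover have "g x \<delta> \<in> range u" using fits[of \<delta> x] unfolding fits_def by blast
    ultimately show "\<exists>e\<in>range u. \<exists>\<zeta>. UNIV \<in> e \<and> {\<epsilon>..<\<zeta>} \<in> e \<and> (\<forall>p\<in>F. tail_sets p \<epsilon> \<subseteq> e)"
      using ultrafilter_onD(2)[OF uf] by blast
  qed
  ultimately show ?thesis using r(1) by blast
qed

end

subsection \<open>Enumerating the tasks\<close>

text \<open>Through a pairing, a subset of \<lambda> is read as a set of pairs, that is, as the
  sequence of its sections.\<close>

lemma surj_set_to_fun_set:
  assumes "infinite (UNIV :: 'a set)"
  shows "\<exists>D :: 'a set \<Rightarrow> 'a \<Rightarrow> 'a set. surj D"
proof -
  obtain h :: "'a \<Rightarrow> 'a \<times> 'a" where h: "surj h" using infinite_pairing[OF assms] by blast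
  define D where "D c i = {j. \<exists>x\<in>c. h x = (i, j)}" for c i
  have "\<kappa> = D {x. snd (h x) \<in> \<kappa> (fst (h x))}" for \<kappa>
  proof
    fix i
    have "\<exists>x. h x = (i, j)" for j using h by (metis surj_def)
    then show "\<kappa> i = D {x. snd (h x) \<in> \<kappa> (fst (h x))} i"
      unfolding D_def by (auto; metis fst_conv snd_conv)
  qed
  then have "surj D" unfolding surj_def by (intro allI exI)
  then show ?thesis by blast
qed

text \<open>A task consists of a set to decide, an \<open>f\<close> to treat and indices of
  conditions to bound. \<open>f\<close> is coded by the singletons \<open>{f i}\<close>, from which
  \<open>SOME\<close> recovers it. The free first component makes every task occur 2^\<lambda>
  times.\<close>

lemma surj_set_to_tasks:
  assumes "infinite (UNIV :: 'a set)"
  shows "\<exists>t :: 'a set \<Rightarrow> 'a set \<times> 'a set \<times> ('a \<Rightarrow> 'a) \<times> ('a \<Rightarrow> 'a set). surj t"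
proof -
  have "infinite (UNIV :: 'a set set)" using assms by (simp add: Finite_Set.finite_set)
  from infinite_pairing[OF this] obtain h :: "'a set \<Rightarrow> 'a set \<times> 'a set" where h: "surj h" by blast
  obtain D :: "'a set \<Rightarrow> 'a \<Rightarrow> 'a set" where D: "surj D" using surj_set_to_fun_set[OF assms] by blast
  define t where "t c = (let (b, c') = h c; (A, c'') = h c'; (F, K) = h c''
      in (b, A, \<lambda>i. SOME j. j \<in> D F i, D K))" for c
  have "\<exists>c. t c = (b, A, f, \<kappa>)" for b A f \<kappa>
  proof -
    obtain K where "D K = \<kappa>" using D by (metis surj_def)
    moreover obtain F where "D F = (\<lambda>i. {f i})" using D by (metis surj_def)
    moreover obtain c'' where "h c'' = (F, K)" using h by (metis surj_def)
    moreover obtain c' where "h c' = (A, c'')" using h by (metis surj_def)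
    moreover obtain c where "h c = (b, c')" using h by (metis surj_def)
    ultimately show ?thesis by (intro exI[of _ c]) (simp add: t_def)
  qed
  then have "surj t" unfolding surj_def by (metis prod_cases4)
  then show ?thesis by blast
qed

text \<open>If \<open>\<kappa>\<close> were unbounded, a \<open>t\<close> with each
  \<open>t i\<close> outside the values \<open>s \<gamma> i\<close> for \<open>\<gamma>\<close>
  below \<open>\<kappa> i\<close> would differ from every \<open>s \<gamma>\<close>. With subsets of
  \<lambda> for \<open>'c\<close>, this says that 2^\<lambda> has cofinality above
  \<lambda>.\<close>

lemma Koenig_bound:
  fixes \<kappa> :: "'a \<Rightarrow> 'c"
  assumes "surj (s :: 'c \<Rightarrow> 'a \<Rightarrow> 'c)"
  shows "\<exists>\<beta>. \<forall>i. (\<kappa> i, \<beta>) \<in> |UNIV :: 'c set|"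
proof (rule ccontr)
  let ?W = "|UNIV :: 'c set|"
  assume "\<not> ?thesis"
  then have n: "\<And>\<beta>. \<exists>i. (\<kappa> i, \<beta>) \<notin> ?W" by blast
  have W: "total ?W" "refl ?W"
    using card_of_well_order_on[of "UNIV :: 'c set"]
    by (auto simp: well_order_on_def linear_order_on_def partial_order_on_def preorder_on_def)
  have "\<exists>c. c \<notin> (\<lambda>\<gamma>. s \<gamma> i) ` underS ?W (\<kappa> i)" for i
  proof -
    have "|underS ?W (\<kappa> i)| <o ?W"
      by (rule card_of_underS[OF card_of_Card_order]) (simp add: Field_card_of)
    then have "|(\<lambda>\<gamma>. s \<gamma> i) ` underS ?W (\<kappa> i)| <o ?W"
      using card_of_image ordLeq_ordLess_trans by blast
    then show ?thesis using not_ordLess_ordIso card_of_refl by (metis UNIV_eq_I)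
  qed
  then obtain t where t: "\<And>i. t i \<notin> (\<lambda>\<gamma>. s \<gamma> i) ` underS ?W (\<kappa> i)" by metis
  obtain \<gamma> where \<gamma>: "s \<gamma> = t" using assms by (metis surj_def)
  obtain i where "(\<kappa> i, \<gamma>) \<notin> ?W" using n by blast
  then have "\<gamma> \<in> underS ?W (\<kappa> i)"
    using W unfolding underS_def total_on_def refl_on_def by (metis (mono_tags, lifting) UNIV_I mem_Collect_eq)
  then show False using t[of i] \<gamma> by blast
qed

text \<open>This reduces the compatibility of finitely many stages of the recursion to the last of
  them.\<close>

lemma finite_has_maximum:
  assumes "well_order_on UNIV W" "finite I" "I \<noteq> {}"
  shows "\<exists>m\<in>I. I \<subseteq> insert m (underS W m)"
  using assms(2,3)
proof (induction rule: finite_ne_induct)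
  case (insert x I)
  then obtain m where m: "m \<in> I" "I \<subseteq> insert m (underS W m)" by blast
  have W: "total W" "trans W"  "antisym W"
    using assms(1) by (auto simp: well_order_on_def linear_order_on_def partial_order_on_def preorder_on_def)
  consider "x = m" | "(x, m) \<in> W" "x \<noteq> m" | "(m, x) \<in> W" "x \<noteq> m" using W(1) unfolding total_on_def by blast
  then show ?case
  proof cases
    case 3
    then have "underS W m \<subseteq> underS W x"
      using W(2,3) unfolding underS_def by (auto dest: transD antisymD)
    then have "insert x I \<subseteq> insert x (underS W x)" using m(2) 3 unfolding underS_def by auto
    then show ?thesis by blast
  qed (use m in \<open>auto simp: underS_def\<close>)
qed auto

lemma compatible_subset: "compatible u B G \<Longrightarrow> F \<subseteq> G \<Longrightarrow> compatible u B F"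
  unfolding compatible_def by (meson order_trans)

section \<open>The recursion of length 2^\<lambda> and the ultrafilter it generates\<close>

context
  assumes lam_card: "card_order (lam :: 'a::wellorder rel)"
    and lam_reg: "regularCard (lam :: 'a rel)"
    and lam_unc: "natLeq <o (lam :: 'a rel)"
begin

text \<open>The conditions that a task wants bounded must be constructed before its stage.
  \<open>Koenig_bound\<close> bounds their indices, fewer than 2^\<lambda> stages precede any given
  one, and each task has 2^\<lambda> copies.\<close>

lemma late_tasks:
  "\<exists>t :: 'a set \<Rightarrow> 'a set \<times> ('a \<Rightarrow> 'a) \<times> ('a \<Rightarrow> 'a set).
     \<forall>A f \<kappa>. \<exists>\<alpha>. t \<alpha> = (A, f, \<kappa>) \<and> range \<kappa> \<subseteq> underS |UNIV :: 'a set set| \<alpha>"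
proof -
  let ?W = "|UNIV :: 'a set set|"
  note inf = infinite_lam[OF lam_card lam_reg lam_unc]
  obtain t :: "'a set \<Rightarrow> 'a set \<times> 'a set \<times> ('a \<Rightarrow> 'a) \<times> ('a \<Rightarrow> 'a set)" where t: "surj t"
    using surj_set_to_tasks[OF inf] by blast
  obtain D :: "'a set \<Rightarrow> 'a \<Rightarrow> 'a set" where D: "surj D" using surj_set_to_fun_set[OF inf] by blast
  have W: "total ?W" "trans ?W" "antisym ?W"
    using card_of_well_order_on[of "UNIV :: 'a set set"]
    by (auto simp: well_order_on_def linear_order_on_def partial_order_on_def preorder_on_def)
  have "\<exists>\<alpha>. snd (t \<alpha>) = (A, f, \<kappa>) \<and> range \<kappa> \<subseteq> underS ?W \<alpha>" for A f \<kappa>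
  proof -
    obtain \<beta> where \<beta>: "\<And>i. (\<kappa> i, \<beta>) \<in> ?W" using Koenig_bound[OF D] by blast
    have "infinite (Field ?W)" using inf by (simp add: Field_card_of Finite_Set.finite_set)
    \<comment> \<open>A strictly larger \<open>\<beta>'\<close> is taken because some
      \<open>\<kappa> i\<close> may equal \<open>\<beta>\<close>.\<close>
    from infinite_Card_order_limit[OF card_of_Card_order this, of \<beta>]
    obtain \<beta>' where \<beta>': "\<beta> \<noteq> \<beta>'" "(\<beta>, \<beta>') \<in> ?W" by (auto simp: Field_card_of)
    have "\<forall>b. \<exists>\<alpha>. t \<alpha> = (b, A, f, \<kappa>)" using t by (metis surj_def)
    then obtain g where g: "\<And>b. t (g b) = (b, A, f, \<kappa>)" by metis
    then have "inj g" by (intro injI) (metis prod.inject)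
    moreover have "|underS ?W \<beta>'| <o ?W"
      by (rule card_of_underS[OF card_of_Card_order]) (simp add: Field_card_of)
    ultimately have "\<not> g ` UNIV \<subseteq> underS ?W \<beta>'" unfolding card_of_ordLess[symmetric] by blast
    then obtain b where "g b \<notin> underS ?W \<beta>'" by blast
    then have b: "(\<beta>', g b) \<in> ?W \<or> g b = \<beta>'" using W(1) unfolding underS_def total_on_def by blast
    have "\<kappa> i \<in> underS ?W (g b)" for i
      using b \<beta>[of i] \<beta>' W(2,3) unfolding underS_def by (auto dest: transD antisymD)
    then show ?thesis using g[of b] by (intro exI[of _ "g b"]) auto
  qed
  then show ?thesis by (intro exI[of _ "\<lambda>\<alpha>. snd (t \<alpha>)"]) blast
qed

text \<open>Recursion along the initial well-order of \<open>'a set\<close>, one task per stage.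
  Compatibility with the earlier conditions is carried along so that
  \<open>compatible_extend\<close> applies.\<close>

lemma generating_family_exists:
  assumes u: "universe (u :: 'a \<Rightarrow> 'a set set)"
    and cov: "|UNIV :: 'a set set| \<le>o cov (meagre_ideal :: ('a \<Rightarrow> 'a) set set)"
  shows "\<exists>R :: 'a set \<Rightarrow> 'a condition. range R \<subseteq> Q0 \<and>
    (\<forall>A f \<kappa>. \<exists>\<alpha>. (A \<in> fil (R \<alpha>) \<or> - A \<in> fil (R \<alpha>)) \<and> (\<forall>i :: 'a. R (\<kappa> i) \<le>\<^sup>0 R \<alpha>) \<and>
       - (\<Union>\<delta>\<in>fst (R \<alpha>). {\<delta>..<oadd \<delta> (f \<delta>)}) \<in> fil (R \<alpha>))"
proof -
  let ?W = "|UNIV :: 'a set set|"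
  note lam = lam_card lam_reg lam_unc
  have wo: "well_order_on UNIV ?W" by (rule card_of_well_order_on)
  obtain t :: "'a set \<Rightarrow> 'a set \<times> ('a \<Rightarrow> 'a) \<times> ('a \<Rightarrow> 'a set)"
    where t: "\<And>A f \<kappa>. \<exists>\<alpha>. t \<alpha> = (A, f, \<kappa>) \<and> range \<kappa> \<subseteq> underS ?W \<alpha>"
    using late_tasks by blast
  \<comment> \<open>The guard \<open>\<kappa> i \<in> underS ?W \<alpha>\<close> confines
    \<open>P\<close> to values of \<open>R\<close> at earlier stages; \<open>late_tasks\<close>
    discharges it after the recursion.\<close>
  define P where "P R \<alpha> r \<longleftrightarrow> r \<in> Q0 \<and> compatible u UNIV (insert r (R ` underS ?W \<alpha>)) \<and>
      (case t \<alpha> of (A, f, \<kappa>) \<Rightarrow> (A \<in> fil r \<or> - A \<in> fil r) \<and>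
         (\<forall>i. \<kappa> i \<in> underS ?W \<alpha> \<longrightarrow> R (\<kappa> i) \<le>\<^sup>0 r) \<and>
         - (\<Union>\<delta>\<in>fst r. {\<delta>..<oadd \<delta> (f \<delta>)}) \<in> fil r)" for R \<alpha> r
  have "\<exists>R. \<forall>\<alpha>. P R \<alpha> (R \<alpha>)"
  proof (rule dependent_wf_choice)
    show "wf (?W - Id)" using wo by (simp add: well_order_on_def)
  next
    fix R R' :: "'a set \<Rightarrow> 'a condition" and \<alpha> r assume "\<And>z. (z, \<alpha>) \<in> ?W - Id \<Longrightarrow> R z = R' z"
    then have eq: "R z = R' z" if "z \<in> underS ?W \<alpha>" for z using that unfolding underS_def by auto
    then have "R ` underS ?W \<alpha> = R' ` underS ?W \<alpha>" by (rule image_cong[OF refl])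
    then show "P R \<alpha> r = P R' \<alpha> r" unfolding P_def using eq by (auto split: prod.splits)
  next
    fix R :: "'a set \<Rightarrow> 'a condition" and \<alpha> assume "\<And>y. (y, \<alpha>) \<in> ?W - Id \<Longrightarrow> P R y (R y)"
    then have IH: "P R y (R y)" if "y \<in> underS ?W \<alpha>" for y using that unfolding underS_def by auto
    have comp: "compatible u UNIV (R ` underS ?W \<alpha>)"
    proof (rule compatible_finite_subsets)
      fix F assume "finite F" "F \<subseteq> R ` underS ?W \<alpha>"
      then obtain I where I: "finite I" "I \<subseteq> underS ?W \<alpha>" "F = R ` I" by (meson finite_subset_image)
      show "compatible u UNIV F"
      proof (cases "I = {}")
        case True
        then show ?thesis using compatible_empty[OF lam u] I(3) by simp
      next
        case False
        \<comment> \<open>All of \<open>F\<close> comes from stages up to \<open>m\<close>, and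
          these were shown compatible at stage \<open>m\<close>.\<close>
        from finite_has_maximum[OF wo I(1) this] obtain m where m: "m \<in> I" "I \<subseteq> insert m (underS ?W m)" by blast
        have "P R m (R m)" using IH m(1) I(2) by blast
        then have "compatible u UNIV (insert (R m) (R ` underS ?W m))" unfolding P_def by (rule conjunct1[OF conjunct2])
        then show ?thesis by (rule compatible_subset) (use m(2) I(3) in auto)
      qed
    qed
    have "|underS ?W \<alpha>| <o ?W"
      by (rule card_of_underS[OF card_of_Card_order]) (simp add: Field_card_of)
    then have small: "|R ` underS ?W \<alpha>| <o ?W" using card_of_image ordLeq_ordLess_trans by blast
    obtain A f \<kappa> where tk: "t \<alpha> = (A, f, \<kappa>)" by (cases "t \<alpha>")
    from compatible_extend[OF lam u comp small cov, of A "\<lambda>i. R (\<kappa> i)" f]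
    show "\<exists>r. P R \<alpha> r" unfolding P_def tk prod.case by blast
  qed
  then obtain R where R: "\<And>\<alpha>. P R \<alpha> (R \<alpha>)" by blast
  have "range R \<subseteq> Q0" using R unfolding P_def by blast
  moreover have "\<exists>\<alpha>. (A \<in> fil (R \<alpha>) \<or> - A \<in> fil (R \<alpha>)) \<and> (\<forall>i. R (\<kappa> i) \<le>\<^sup>0 R \<alpha>) \<and>
       - (\<Union>\<delta>\<in>fst (R \<alpha>). {\<delta>..<oadd \<delta> (f \<delta>)}) \<in> fil (R \<alpha>)" for A f and \<kappa> :: "'a \<Rightarrow> 'a set"
  proof -
    obtain \<alpha> where \<alpha>: "t \<alpha> = (A, f, \<kappa>)" "range \<kappa> \<subseteq> underS ?W \<alpha>" using t by blast
    then have "\<kappa> i \<in> underS ?W \<alpha>" for i by blast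
    then show ?thesis using R[of \<alpha>] unfolding P_def \<alpha>(1) prod.case by (intro exI[of _ \<alpha>]) simp
  qed
  ultimately show ?thesis by blast
qed

text \<open>In the second hypothesis, \<open>\<kappa>\<close> gives directedness, \<open>A\<close>
  the ultrafilter property, and \<open>f\<close> weak reasonableness with the club
  \<open>fst (R \<alpha>)\<close>.\<close>

lemma very_reasonable_fil_of_set:
  assumes R: "range R \<subseteq> (Q0 :: 'a condition set)"
    and ext: "\<And>A f \<kappa>. \<exists>\<alpha>. (A \<in> fil (R \<alpha>) \<or> - A \<in> fil (R \<alpha>)) \<and> (\<forall>i :: 'a. R (\<kappa> i) \<le>\<^sup>0 R \<alpha>) \<and>
       - (\<Union>\<delta>\<in>fst (R \<alpha>). {\<delta>..<oadd \<delta> (f \<delta>)}) \<in> fil (R \<alpha>)"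
  shows "very_reasonable (fil_of_set (range R))"
proof -
  note lam = lam_card lam_reg lam_unc
  let ?D = "fil_of_set (range R)"
  have mem: "A \<in> ?D \<longleftrightarrow> (\<exists>\<alpha>. A \<in> fil (R \<alpha>))" for A unfolding fil_of_set_def by blast
  have Q: "R \<alpha> \<in> Q0" for \<alpha> using R by blast
  have dir: "directed_lam_plus (range R)"
    unfolding directed_lam_plus_def
  proof (intro allI impI)
    fix H assume H: "H \<subseteq> range R" "|H| \<le>o (lam :: 'a rel)"
    have "\<exists>\<kappa> :: 'a \<Rightarrow> _. H \<subseteq> range (\<lambda>i. R (\<kappa> i))"
    proof (cases "H = {}")
      case False
      have "|H| \<le>o |UNIV :: 'a set|" using H(2) lam_ordIso[OF lam] ordLeq_ordIso_trans by blast
      then obtain g :: "'a \<Rightarrow> _" where g: "range g = H"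
        unfolding card_of_ordLeq2[OF False, symmetric] ..
      then have "\<forall>i. \<exists>\<alpha>. g i = R \<alpha>" using H(1) by blast
      then obtain \<kappa> where "\<forall>i. g i = R (\<kappa> i)" by (auto dest!: choice)
      then have "H \<subseteq> range (\<lambda>i. R (\<kappa> i))" using g by auto
      then show ?thesis by (rule exI[of _ \<kappa>])
    qed simp
    then obtain \<kappa> :: "'a \<Rightarrow> _" where \<kappa>: "H \<subseteq> range (\<lambda>i. R (\<kappa> i))" by blast
    obtain \<alpha> where "\<forall>i. R (\<kappa> i) \<le>\<^sup>0 R \<alpha>" using ext by blast
    then show "\<exists>q\<in>range R. \<forall>p\<in>H. p \<le>\<^sup>0 q" using \<kappa> by (intro bexI[of _ "R \<alpha>"]) auto
  qed
  have pair: "\<exists>\<alpha>. fil (R \<beta>) \<subseteq> fil (R \<alpha>) \<and> fil (R \<gamma>) \<subseteq> fil (R \<alpha>)" for \<beta> \<gamma>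
  proof -
    \<comment> \<open>Two distinct indices let a single \<open>\<kappa>\<close> take both values
      \<open>\<beta>\<close> and \<open>\<gamma>\<close>.\<close>
    obtain i j :: 'a where "i < j" using greater_exists[OF lam] by blast
    from ext[of UNIV "\<lambda>l. if l = i then \<beta> else \<gamma>" id] obtain \<alpha>
      where \<alpha>: "\<forall>l :: 'a. R (if l = i then \<beta> else \<gamma>) \<le>\<^sup>0 R \<alpha>" by (elim exE conjE) (rule that)
    show ?thesis using \<alpha>[rule_format, of i] \<alpha>[rule_format, of j] less_imp_neq[OF \<open>i < j\<close>]
      unfolding le0_def by (intro exI[of _ \<alpha>]) simp
  qed
  have Int: "A \<inter> B \<in> ?D" if AB: "A \<in> ?D" "B \<in> ?D" for A B
  proof -
    obtain \<beta> \<gamma> where "A \<in> fil (R \<beta>)" "B \<in> fil (R \<gamma>)" using AB unfolding mem by blast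
    then obtain \<alpha> where "A \<in> fil (R \<alpha>)" "B \<in> fil (R \<alpha>)" using pair[of \<beta> \<gamma>] by blast
    then show ?thesis using fil_Int[OF Q] unfolding mem by blast
  qed
  have unb: "\<exists>\<beta>\<in>A. \<alpha> \<le> \<beta>" if "A \<in> ?D" for A \<alpha> using that fil_unbounded[OF Q] unfolding mem by blast
  have ult: "A \<in> ?D \<or> - A \<in> ?D" for A using ext unfolding mem by blast
  have up: "B \<in> ?D" if "A \<in> ?D" "A \<subseteq> B" for A B using that fil_up[OF Q] unfolding mem by blast
  have emp: "{} \<notin> ?D" using unb by blast
  have "UNIV \<in> ?D" using ult[of UNIV] emp by auto
  then have uf: "ultrafilter_on UNIV ?D"
    unfolding ultrafilter_on_def using emp up Int ult by (auto simp: Compl_eq_Diff_UNIV)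
  have "uniform_ultrafilter ?D"
    unfolding uniform_ultrafilter_def using uf unbounded_ordIso[OF lam unb] by blast
  moreover have "\<exists>C. club C \<and> (\<Union>\<delta>\<in>C. {\<delta>..<oadd \<delta> (f \<delta>)}) \<notin> ?D" for f
  proof -
    obtain \<alpha> where "- (\<Union>\<delta>\<in>fst (R \<alpha>). {\<delta>..<oadd \<delta> (f \<delta>)}) \<in> fil (R \<alpha>)" using ext by blast
    then have "- (\<Union>\<delta>\<in>fst (R \<alpha>). {\<delta>..<oadd \<delta> (f \<delta>)}) \<in> ?D" unfolding mem by blast
    then have "(\<Union>\<delta>\<in>fst (R \<alpha>). {\<delta>..<oadd \<delta> (f \<delta>)}) \<notin> ?D" using ultrafilter_onD(6)[OF uf] by blast
    then show ?thesis using Q0_club[OF Q] by blast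
  qed
  ultimately have "weakly_reasonable ?D" unfolding weakly_reasonable_def by blast
  then show ?thesis unfolding very_reasonable_def using R dir by blast
qed

end

theorem theorem3p14:
  assumes "card_order (lam :: 'a::wellorder rel)"
    and "regularCard (lam :: 'a rel)"
    and "natLeq <o (lam :: 'a rel)"
    and "|short_seqs :: ('a \<rightharpoonup> 'a) set| =o (lam :: 'a rel)"
    and "cov (meagre_ideal :: ('a \<Rightarrow> 'a) set set) =o ctwo ^c (lam :: 'a rel)"
  shows "\<exists>D :: 'a set set. very_reasonable D"
proof -
  note lam = assms(1-3)
  have "|UNIV :: 'a set set| =o |Func (UNIV :: 'a set) (UNIV :: bool set)|"
    using card_of_Pow_Func[of "UNIV :: 'a set"] by simp
  moreover have "ctwo ^c (lam :: 'a rel) = |Func (UNIV :: 'a set) (UNIV :: bool set)|"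
    unfolding cexp_def ctwo_def Field_card_of Field_lam[OF lam] ..
  ultimately have cov: "|UNIV :: 'a set set| \<le>o cov (meagre_ideal :: ('a \<Rightarrow> 'a) set set)"
    using assms(5) by (metis ordIso_iff_ordLeq ordIso_symmetric ordIso_transitive)
  obtain u :: "'a \<Rightarrow> 'a set set" where "universe u" using universe_exists[OF assms(1-4)] by blast
  from generating_family_exists[OF lam this cov] obtain R :: "'a set \<Rightarrow> 'a condition"
    where R: "range R \<subseteq> Q0" and ext: "\<forall>A f \<kappa>. \<exists>\<alpha>. (A \<in> fil (R \<alpha>) \<or> - A \<in> fil (R \<alpha>)) \<and>
      (\<forall>i :: 'a. R (\<kappa> i) \<le>\<^sup>0 R \<alpha>) \<and> - (\<Union>\<delta>\<in>fst (R \<alpha>). {\<delta>..<oadd \<delta> (f \<delta>)}) \<in> fil (R \<alpha>)" by blast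
  show ?thesis using very_reasonable_fil_of_set[OF lam R ext[rule_format]] by blast
qed

end
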